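(* There is an algorithm that, given a tree $T$ with at least three vertices, computes a minimum $\Delta$-completion set of $T$ in time linear in the number of vertices of $T$.
   Context: A $\Delta$-completion set of a graph $G$ is a set $F$ of non-edges of $G$ such that every vertex of $G+F$ lies in a triangle; it is minimum if it has the smallest possible size. *)

theory Defs
  imports Main
begin

section \<open>Simple graphs, trees and triangle completions\<close>

text \<open>A simple graph is given by a vertex set \<open>V\<close> and a set \<open>E\<close> of two-element
  subsets of \<open>V\<close>.\<close>

definition non_loops :: "'a set \<Rightarrow> 'a set set" where
  "non_loops V = {{u, v} | u v. u \<in> V \<and> v \<in> V \<and> u \<noteq> v}"

definition simple_graph :: "'a set \<Rightarrow> 'a set set \<Rightarrow> bool" where
  "simple_graph V E \<longleftrightarrow> finite V \<and> E \<subseteq> non_loops V"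

definition connected_graph :: "'a set \<Rightarrow> 'a set set \<Rightarrow> bool" where
  "connected_graph V E \<longleftrightarrow>
     V \<noteq> {} \<and> (\<forall>u\<in>V. \<forall>v\<in>V. (u, v) \<in> {(x, y). {x, y} \<in> E}\<^sup>*)"

definition graph_cycle :: "'a set set \<Rightarrow> 'a list \<Rightarrow> bool" where
  "graph_cycle E p \<longleftrightarrow> length p \<ge> 3 \<and> distinct p \<and>
     (\<forall>i. Suc i < length p \<longrightarrow> {p ! i, p ! Suc i} \<in> E) \<and> {last p, hd p} \<in> E"

definition tree_graph :: "'a set \<Rightarrow> 'a set set \<Rightarrow> bool" where
  "tree_graph V E \<longleftrightarrow>
     simple_graph V E \<and> connected_graph V E \<and> \<not> (\<exists>p. graph_cycle E p)"

definition in_triangle :: "'a set set \<Rightarrow> 'a \<Rightarrow> bool" where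
  "in_triangle E v \<longleftrightarrow> (\<exists>x y. v \<noteq> x \<and> v \<noteq> y \<and> x \<noteq> y \<and>
     {v, x} \<in> E \<and> {v, y} \<in> E \<and> {x, y} \<in> E)"

definition triangle_completion :: "'a set \<Rightarrow> 'a set set \<Rightarrow> 'a set set \<Rightarrow> bool" where
  "triangle_completion V E F \<longleftrightarrow>
     F \<subseteq> non_loops V - E \<and> (\<forall>v\<in>V. in_triangle (E \<union> F) v)"

definition min_triangle_completion :: "'a set \<Rightarrow> 'a set set \<Rightarrow> 'a set set \<Rightarrow> bool" where
  "min_triangle_completion V E F \<longleftrightarrow> triangle_completion V E F \<and>
     (\<forall>F'. triangle_completion V E F' \<longrightarrow> card F \<le> card F')"


section \<open>A word RAM\<close>

text \<open>
  Algorithms are programs of a first-order imperative language with unit-cost instructions.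
  A program mentions finitely many scalar variables (registers) and finitely many
  one-dimensional arrays, both named by numbers; array names are fixed in the program text,
  only indices are computed. All data are natural numbers.

  Executions are relative to a word bound \<open>W\<close>: there is no transition that would store a
  number greater than \<open>W\<close> or address an array cell beyond \<open>W\<close>. When \<open>W\<close> is polynomial in
  the input size, this is the usual word RAM with words of logarithmic length, and charging
  one time unit per instruction is sound.
\<close>

datatype operand = N nat | V nat

datatype test = Less operand operand | Equal operand operand

datatype com =
    Assign nat operand
  | Add nat operand operand
  | Sub nat operand operand
  | Load nat nat operand       (* Load x a i: variable x gets cell i of array a *)
  | Store nat operand operand  (* Store a i y: cell i of array a gets y *)
  | Seq com com
  | If test com com
  | While test com

text \<open>A state consists of the scalar variables and the arrays (array name, then index).\<close>

type_synonym state = "(nat \<Rightarrow> nat) \<times> (nat \<Rightarrow> nat \<Rightarrow> nat)"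

fun val :: "operand \<Rightarrow> (nat \<Rightarrow> nat) \<Rightarrow> nat" where
  "val (N k) s = k"
| "val (V x) s = s x"

fun holds :: "test \<Rightarrow> (nat \<Rightarrow> nat) \<Rightarrow> bool" where
  "holds (Less a b) s \<longleftrightarrow> val a s < val b s"
| "holds (Equal a b) s \<longleftrightarrow> val a s = val b s"

text \<open>\<open>exec W c \<sigma> t \<sigma>'\<close>: started in \<open>\<sigma>\<close>, the program \<open>c\<close> halts in \<open>\<sigma>'\<close> after \<open>t\<close> steps without
  exceeding the word bound \<open>W\<close>. Every evaluation of a test and every elementary instruction
  costs one step. Subtraction is truncated.\<close>

inductive exec :: "nat \<Rightarrow> com \<Rightarrow> state \<Rightarrow> nat \<Rightarrow> state \<Rightarrow> bool" for W :: nat where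
  Assign: "val a s \<le> W \<Longrightarrow> exec W (Assign x a) (s, A) 1 (s(x := val a s), A)"
| Add: "val a s + val b s \<le> W \<Longrightarrow>
    exec W (Add x a b) (s, A) 1 (s(x := val a s + val b s), A)"
| Sub: "val a s - val b s \<le> W \<Longrightarrow>
    exec W (Sub x a b) (s, A) 1 (s(x := val a s - val b s), A)"
| Load: "val i s \<le> W \<Longrightarrow> A r (val i s) \<le> W \<Longrightarrow>
    exec W (Load x r i) (s, A) 1 (s(x := A r (val i s)), A)"
| Store: "val i s \<le> W \<Longrightarrow> val a s \<le> W \<Longrightarrow>
    exec W (Store r i a) (s, A) 1 (s, A(r := (A r)(val i s := val a s)))"
| Seq: "exec W c1 \<sigma> t1 \<sigma>' \<Longrightarrow> exec W c2 \<sigma>' t2 \<sigma>'' \<Longrightarrow>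
    exec W (Seq c1 c2) \<sigma> (t1 + t2) \<sigma>''"
| IfTrue: "holds b (fst \<sigma>) \<Longrightarrow> exec W c1 \<sigma> t \<sigma>' \<Longrightarrow> exec W (If b c1 c2) \<sigma> (Suc t) \<sigma>'"
| IfFalse: "\<not> holds b (fst \<sigma>) \<Longrightarrow> exec W c2 \<sigma> t \<sigma>' \<Longrightarrow> exec W (If b c1 c2) \<sigma> (Suc t) \<sigma>'"
| WhileFalse: "\<not> holds b (fst \<sigma>) \<Longrightarrow> exec W (While b c) \<sigma> 1 \<sigma>"
| WhileTrue: "holds b (fst \<sigma>) \<Longrightarrow> exec W c \<sigma> t1 \<sigma>' \<Longrightarrow> exec W (While b c) \<sigma>' t2 \<sigma>'' \<Longrightarrow>
    exec W (While b c) \<sigma> (Suc (t1 + t2)) \<sigma>''"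

inductive_cases exec_elims:
  "exec W (Assign x a) \<sigma> t \<sigma>'"
  "exec W (Add x a b) \<sigma> t \<sigma>'"
  "exec W (Sub x a b) \<sigma> t \<sigma>'"
  "exec W (Load x r i) \<sigma> t \<sigma>'"
  "exec W (Store r i a) \<sigma> t \<sigma>'"
  "exec W (Seq c1 c2) \<sigma> t \<sigma>'"
  "exec W (If b c1 c2) \<sigma> t \<sigma>'"
  "exec W (While b c) \<sigma> t \<sigma>'"

lemma exec_deterministic:
  assumes "exec W c \<sigma> t \<sigma>'" and "exec W c \<sigma> u \<sigma>''"
  shows "u = t \<and> \<sigma>'' = \<sigma>'"
  using assms
proof (induction arbitrary: u \<sigma>'' rule: exec.induct)
  case (Seq c1 \<sigma> t1 \<sigma>1 c2 t2 \<sigma>2)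
  from Seq.prems show ?case
    by (rule exec_elims(6)) (use Seq.IH in blast)
next
  case (IfTrue b \<sigma> c1 t \<sigma>1 c2)
  from IfTrue.prems show ?case
    by (rule exec_elims(7)) (use IfTrue.hyps IfTrue.IH in blast)+
next
  case (IfFalse b \<sigma> c2 t \<sigma>1 c1)
  from IfFalse.prems show ?case
    by (rule exec_elims(7)) (use IfFalse.hyps IfFalse.IH in blast)+
next
  case (WhileFalse b \<sigma> c)
  from WhileFalse.prems show ?case
    by (rule exec_elims(8)) (use WhileFalse.hyps in auto)
next
  case (WhileTrue b \<sigma> c t1 \<sigma>1 t2 \<sigma>2)
  from WhileTrue.prems show ?case
    by (rule exec_elims(8)) (use WhileTrue.hyps WhileTrue.IH in blast)+
qed (auto elim: exec_elims)


section \<open>Input and output format\<close>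

text \<open>A state stores a set \<open>F\<close> of edges on natural numbers if variable 1 holds the number of
  edges and the first cells of the arrays 0 and 1 hold the two endpoints of each edge, where
  every edge occurs exactly once, edges and endpoints being in arbitrary order.\<close>

definition stores_edges :: "state \<Rightarrow> nat set set \<Rightarrow> bool" where
  "stores_edges \<sigma> F \<longleftrightarrow>
     (case \<sigma> of (s, A) \<Rightarrow> bij_betw (\<lambda>i. {A 0 i, A 1 i}) {..<s 1} F)"

text \<open>Initial states for the graph with vertex set \<open>{..<n}\<close> and edge set \<open>E\<close>: the edges are
  stored as above, variable 0 holds \<open>n\<close>, and all other memory is zero.\<close>

definition input_state :: "nat \<Rightarrow> nat set set \<Rightarrow> state \<Rightarrow> bool" where
  "input_state n E \<sigma> \<longleftrightarrow> stores_edges \<sigma> E \<and>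
     (case \<sigma> of (s, A) \<Rightarrow> s 0 = n \<and> (\<forall>x\<ge>2. s x = 0) \<and>
       (\<forall>a i. a \<ge> 2 \<or> i \<ge> s 1 \<longrightarrow> A a i = 0))"

end

theory Submission
  imports Defs
begin

text \<open>The minimum size of a completion equals the minimum number of three-vertex paths of the tree
  that cover all vertices: joining the end points of the paths of a cover gives a completion, and
  conversely every completion \<open>F\<close> can be traded for a cover with at most \<open>card F\<close> paths.

  A minimum path cover is found greedily by removing leaves one after another. At any time every
  removed vertex is covered, except that each remaining vertex \<open>p\<close> may have one removed
  uncovered child. When a leaf \<open>u\<close> with neighbour \<open>p\<close> is removed, an uncovered child \<open>w\<close> of \<open>u\<close>
  is covered by the path \<open>w, u, p\<close>; otherwise, if \<open>u\<close> is uncovered and \<open>p\<close> already has an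
  uncovered child \<open>z\<close>, the path \<open>u, p, z\<close> is chosen. An exchange argument shows that the paths
  chosen so far always extend to a minimum cover. At most one more path is needed for the last
  vertex.

  Leaves are found by following, from each vertex in increasing order, the chain of parents as
  long as they are leaves, which takes amortised constant time per vertex.\<close>

section \<open>Acyclic and connected graphs\<close>

definition nbrs :: "'a set set \<Rightarrow> 'a \<Rightarrow> 'a set" where
  "nbrs E v = {z. {v, z} \<in> E}"

lemma non_loopsD: "{u, v} \<in> non_loops U \<Longrightarrow> u \<in> U \<and> v \<in> U \<and> u \<noteq> v"
  by (auto simp: non_loops_def doubleton_eq_iff)

lemma finite_nbrs: "finite U \<Longrightarrow> E \<subseteq> non_loops U \<Longrightarrow> finite (nbrs E v)"
  by (rule finite_subset[of _ U]) (auto simp: nbrs_def dest!: subsetD non_loopsD)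

lemma finite_edges:
  assumes "finite U" "E \<subseteq> non_loops U" shows "finite E"
proof -
  have "E \<subseteq> Pow U" using assms(2) by (auto simp: non_loops_def)
  then show ?thesis using assms(1) by (meson finite_Pow_iff finite_subset)
qed

text \<open>Extend a longest path at its front: the new neighbour already lies on it and closes a cycle.\<close>

lemma acyclic_low_degree:
  assumes fin: "finite U" and E: "E \<subseteq> non_loops U" and ne: "U \<noteq> {}"
    and acyc: "\<not> (\<exists>p. graph_cycle E p)"
  shows "\<exists>v\<in>U. card (nbrs E v) \<le> 1"
proof (rule ccontr)
  assume "\<not> ?thesis"
  then have big: "card (nbrs E v) \<ge> 2" if "v \<in> U" for v using that by force
  define path where "path p \<longleftrightarrow> p \<noteq> [] \<and> distinct p \<and> set p \<subseteq> U \<and>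
     (\<forall>i. Suc i < length p \<longrightarrow> {p ! i, p ! Suc i} \<in> E)" for p
  obtain v where "v \<in> U" using ne by blast
  then have "path [v]" by (simp add: path_def)
  moreover have "length p < Suc (card U)" if "path p" for p
    using that fin by (metis card_mono distinct_card less_Suc_eq_le path_def)
  ultimately obtain p where p: "path p" and max: "\<And>q. path q \<Longrightarrow> length q \<le> length p"
    using ex_has_greatest_nat[of path "[v]" length "Suc (card U)"] by blast
  then have pne: "p \<noteq> []" by (simp add: path_def)
  define h where "h = hd p"
  have h: "h \<in> U" using p by (auto simp: path_def h_def)
  \<comment> \<open>If \<open>p\<close> has length 1, then \<open>p ! 1\<close> is an unspecified
    value; all that matters is that a single value cannot exhaust two neighbours.\<close>
  have "\<not> nbrs E h \<subseteq> {p ! 1}"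
    using big[OF h] card_mono[of "{p ! 1}" "nbrs E h"] by auto
  then obtain z where z: "{h, z} \<in> E" "z \<noteq> p ! 1" by (auto simp: nbrs_def)
  have zV: "z \<in> U" "z \<noteq> h" using z E non_loopsD[of h z U] by auto
  have "z \<in> set p"
  proof (rule ccontr)
    assume "z \<notin> set p"
    then have "path (z # p)"
      using p zV z pne
      by (auto simp: path_def nth_Cons h_def hd_conv_nth insert_commute split: nat.splits)
    then show False using max by fastforce
  qed
  then obtain j where j: "j < length p" "p ! j = z" by (auto simp: in_set_conv_nth)
  have "j \<noteq> 0" using j zV pne by (metis h_def hd_conv_nth)
  moreover have "j \<noteq> 1" using j z by auto
  ultimately have j2: "j \<ge> 2" by linarith
  have "last (take (Suc j) p) = z" using j by (simp add: take_Suc_conv_app_nth)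
  moreover have "hd (take (Suc j) p) = h" by (simp add: h_def hd_take)
  ultimately have "graph_cycle E (take (Suc j) p)"
    using p j j2 z by (auto simp: graph_cycle_def path_def insert_commute)
  then show False using acyc by blast
qed

lemma graph_cycle_mono: "graph_cycle E p \<Longrightarrow> E \<subseteq> E' \<Longrightarrow> graph_cycle E' p"
  by (auto simp: graph_cycle_def)

text \<open>Deleting a vertex of degree at most 1 loses at most one edge and keeps the graph
  acyclic. The bound makes the edge list linear in the number of vertices, for the running time and
  the word bound.\<close>

lemma acyclic_card_edges:
  assumes "finite U" "E \<subseteq> non_loops U" "\<not> (\<exists>p. graph_cycle E p)"
  shows "card E \<le> card U"
  using assms
proof (induction "card U" arbitrary: U E)
  case 0
  then show ?case by (auto simp: non_loops_def)
next
  case (Suc m)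
  then have "U \<noteq> {}" by auto
  then obtain v where v: "v \<in> U" "card (nbrs E v) \<le> 1"
    using acyclic_low_degree[OF Suc.prems(1,2) _ Suc.prems(3)] by blast
  define E' where "E' = {e \<in> E. v \<notin> e}"
  have sub: "E' \<subseteq> non_loops (U - {v})"
    using Suc.prems(2) by (fastforce simp: E'_def non_loops_def)
  have "card E' \<le> card (U - {v})"
    using Suc.hyps(2) Suc.prems v sub graph_cycle_mono[of E' _ E]
    by (intro Suc.hyps(1)) (auto simp: E'_def)
  moreover have "E \<subseteq> E' \<union> (\<lambda>z. {v, z}) ` nbrs E v"
    using Suc.prems(2) by (fastforce simp: E'_def non_loops_def nbrs_def image_iff insert_commute)
  then have "card E \<le> card (E' \<union> (\<lambda>z. {v, z}) ` nbrs E v)"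
    using finite_edges[OF Suc.prems(1,2)] finite_nbrs[OF Suc.prems(1,2)]
    by (intro card_mono) (auto simp: E'_def)
  moreover have "card (E' \<union> (\<lambda>z. {v, z}) ` nbrs E v) \<le> card E' + card (nbrs E v)"
    using card_Un_le card_image_le finite_nbrs Suc.prems
    by (metis (no_types, lifting) add_left_mono le_trans)
  ultimately show ?case using v Suc.prems by (simp add: Suc.hyps(2)[symmetric])
qed

text \<open>Connectivity of the subgraph induced by \<open>R\<close>, in the form that every cut is
  crossed; no walks have to be rerouted when a leaf is deleted.\<close>

definition cut_connected :: "'a set \<Rightarrow> 'a set set \<Rightarrow> bool" where
  "cut_connected R E \<longleftrightarrow> (\<forall>S. S \<subseteq> R \<and> S \<noteq> {} \<and> S \<noteq> R \<longrightarrow> (\<exists>a\<in>S. \<exists>b\<in>R - S. {a, b} \<in> E))"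

lemma cut_connectedD:
  "cut_connected R E \<Longrightarrow> S \<subseteq> R \<Longrightarrow> S \<noteq> {} \<Longrightarrow> S \<noteq> R \<Longrightarrow> \<exists>a\<in>S. \<exists>b\<in>R - S. {a, b} \<in> E"
  by (auto simp: cut_connected_def)

lemma connected_imp_cut_connected:
  assumes "connected_graph U E" "E \<subseteq> non_loops U"
  shows "cut_connected U E"
  unfolding cut_connected_def
proof (intro allI impI)
  fix S assume S: "S \<subseteq> U \<and> S \<noteq> {} \<and> S \<noteq> U"
  then obtain a b where ab: "a \<in> S" "b \<in> U" "b \<notin> S" by blast
  have "(a, b) \<in> {(x, y). {x, y} \<in> E}\<^sup>*"
    using assms(1) ab S by (auto simp: connected_graph_def)
  then have "b \<in> S \<or> (\<exists>a\<in>S. \<exists>b\<in>U - S. {a, b} \<in> E)"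
  proof (induction rule: rtrancl_induct)
    case (step y z)
    then show ?case using assms(2) non_loopsD[of y z U] by blast
  qed (use ab in simp)
  then show "\<exists>a\<in>S. \<exists>b\<in>U - S. {a, b} \<in> E" using ab by blast
qed

lemma cut_connected_remove_leaf:
  assumes "cut_connected R E" "nbrs E u \<inter> R = {p}" 
  shows "cut_connected (R - {u}) E"
  unfolding cut_connected_def
proof (intro allI impI)
  fix S assume S: "S \<subseteq> R - {u} \<and> S \<noteq> {} \<and> S \<noteq> R - {u}"
  have p: "z = p" if "z \<in> R" "{u, z} \<in> E" for z using assms(2) that by (auto simp: nbrs_def)
  \<comment> \<open>The leaf is put on the side of its neighbour, so its own edge cannot be the
    crossing edge.\<close>
  let ?S = "if p \<in> S then insert u S \<inter> R else S"
  have "\<exists>a\<in>?S. \<exists>b\<in>R - ?S. {a, b} \<in> E"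
    by (rule cut_connectedD[OF assms(1)]) (use S in \<open>auto split: if_splits\<close>)
  then show "\<exists>a\<in>S. \<exists>b\<in>R - {u} - S. {a, b} \<in> E"
    using p S by (auto split: if_splits simp: insert_commute)
qed

definition p3s :: "'a set set \<Rightarrow> 'a set set" where
  "p3s E = {{a, b, c} | a b c. {a, b} \<in> E \<and> {b, c} \<in> E \<and> a \<noteq> c}"

lemma p3sI: "{a, b} \<in> E \<Longrightarrow> {b, c} \<in> E \<Longrightarrow> a \<noteq> c \<Longrightarrow> {a, b, c} \<in> p3s E"
  by (auto simp: p3s_def)

section \<open>Covers by three-vertex paths\<close>

lemma card_insert_remove1_le:
  "finite P \<Longrightarrow> X \<in> P \<Longrightarrow> card (insert Q (P - {X})) \<le> card P"
  by (metis card_Suc_Diff1 card_insert_if finite_Diff le_SucI order_refl)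

lemma card_insert2_remove2_le:
  assumes "finite P" "X \<in> P" "X' \<in> P" "X \<noteq> X'"
  shows "card (insert Q (insert Q' (P - {X, X'}))) \<le> card P"
proof -
  have "P - {X, X'} = (P - {X}) - {X'}" by blast
  then have "card (insert Q (insert Q' (P - {X, X'}))) \<le> Suc (card (insert Q' ((P - {X}) - {X'})))"
    using assms(1) by (simp add: card_insert_if)
  also have "\<dots> \<le> Suc (card (P - {X}))"
    using assms card_insert_remove1_le[of "P - {X}" X' Q'] by auto
  also have "\<dots> = card P" using assms card_Suc_Diff1 by metis
  finally show ?thesis .
qed

definition p3_cover :: "'a set \<Rightarrow> 'a set set \<Rightarrow> 'a set set \<Rightarrow> bool" where
  "p3_cover U E P \<longleftrightarrow> P \<subseteq> p3s E \<and> U \<subseteq> \<Union>P"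

lemma p3_cover_exchange:
  assumes "p3_cover U E P" "K \<subseteq> p3s E" "M \<subseteq> P - R" "\<Union>R \<subseteq> \<Union>K \<union> \<Union>M"
  shows "p3_cover U E (K \<union> (P - R))"
proof -
  have "\<Union>P \<subseteq> \<Union>R \<union> \<Union>(P - R)" by blast
  also have "\<dots> \<subseteq> \<Union>(K \<union> (P - R))" using assms(3,4) by blast
  finally show ?thesis
    using assms(1,2) unfolding p3_cover_def by (meson Diff_subset Un_least subset_trans)
qed

text \<open>\<open>M\<close> is a safe partial choice: completing it never costs more than any given
  cover. Quantifying over all covers lets single exchanges compose.\<close>

definition extendable :: "'a set \<Rightarrow> 'a set set \<Rightarrow> 'a set set \<Rightarrow> bool" where
  "extendable U E M \<longleftrightarrow> M \<subseteq> p3s E \<and>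
     (\<forall>P. p3_cover U E P \<longrightarrow> (\<exists>P'. p3_cover U E P' \<and> M \<subseteq> P' \<and> card P' \<le> card P))"

section \<open>Completions and path covers of a tree with at least three vertices\<close>

locale big_tree =
  fixes U :: "'a set" and E :: "'a set set"
  assumes tree: "tree_graph U E" and big: "card U \<ge> 3"
begin

lemma fin: "finite U" and edges: "E \<subseteq> non_loops U" and acyc: "\<not> (\<exists>p. graph_cycle E p)"
  using tree by (auto simp: tree_graph_def simple_graph_def)

lemma cut_conn: "cut_connected U E"
  using tree edges by (auto simp: tree_graph_def intro: connected_imp_cut_connected)

lemma edgeD: "{a, b} \<in> E \<Longrightarrow> a \<in> U \<and> b \<in> U \<and> a \<noteq> b"
  using edges non_loopsD[of a b U] by blast

lemma no_triangle: "{a, b} \<in> E \<Longrightarrow> {b, c} \<in> E \<Longrightarrow> {a, c} \<notin> E"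
proof
  assume abc: "{a, b} \<in> E" "{b, c} \<in> E" "{a, c} \<in> E"
  then have "graph_cycle E [a, b, c]"
    using edgeD by (auto simp: graph_cycle_def less_Suc_eq insert_commute)
  then show False using acyc by blast
qed

text \<open>As there is a third vertex, the cut around the two ends is crossed by an edge, which
  prolongs \<open>{a, b}\<close> to a path.\<close>

lemma edge_in_p3:
  assumes "{a, b} \<in> E" shows "\<exists>X\<in>p3s E. {a, b} \<subseteq> X"
proof -
  have "{a, b} \<noteq> U" using big card_2_iff[of U] edgeD[OF assms] by auto
  then obtain x y where "x \<in> {a, b}" "y \<in> U - {a, b}" "{x, y} \<in> E"
    using cut_connectedD[OF cut_conn, of "{a, b}"] edgeD[OF assms] by auto
  then have "{b, a, y} \<in> p3s E \<or> {a, b, y} \<in> p3s E"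
    using assms p3sI[of a b E y] p3sI[of b a E y] by (auto simp: insert_commute)
  then show ?thesis by (elim disjE) (erule bexI[rotated], simp)+
qed

lemma vertex_in_p3:
  assumes "a \<in> U" shows "\<exists>X\<in>p3s E. a \<in> X"
proof -
  have "{a} \<noteq> U" using big by auto
  then obtain b where "{a, b} \<in> E"
    using cut_connectedD[OF cut_conn, of "{a}"] assms by auto
  then show ?thesis using edge_in_p3 by blast
qed

lemma p3s_subset: "X \<in> p3s E \<Longrightarrow> X \<subseteq> U"
  using edgeD by (auto simp: p3s_def)

lemma finite_p3s: "P \<subseteq> p3s E \<Longrightarrow> finite P"
  using p3s_subset fin by (meson PowI finite_Pow_iff finite_subset subsetI subset_trans)

text \<open>Grow a vertex set \<open>X\<close> that can be covered by at most as many paths as there are edges of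
  \<open>F\<close> inside \<open>X\<close>, starting from the paths whose end points are joined by \<open>F\<close>. The triangle of a
  vertex outside \<open>X\<close> always allows a further extension.\<close>

lemma p3_cover_of_completion:
  assumes "triangle_completion U E F"
  shows "\<exists>P. p3_cover U E P \<and> card P \<le> card F"
proof -
  have FN: "F \<subseteq> non_loops U" "F \<inter> E = {}" and tri: "\<And>v. v \<in> U \<Longrightarrow> in_triangle (E \<union> F) v"
    using assms by (auto simp: triangle_completion_def)
  have FD: "a \<in> U \<and> b \<in> U \<and> a \<noteq> b" if "{a, b} \<in> F" for a b
    using FN(1) non_loopsD[of a b U] that by blast
  have finF: "finite F" using finite_edges fin FN by blast
  \<comment> \<open>These added edges close a tree path to a triangle; each pays for one such
    path.\<close>
  define F1 where "F1 = {e \<in> F. \<exists>a b c. e = {a, c} \<and> {a, b} \<in> E \<and> {b, c} \<in> E}"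
  define good where "good X \<longleftrightarrow> X \<subseteq> U \<and>
    (\<exists>P\<subseteq>p3s E. X \<subseteq> \<Union>P \<and> card P \<le> card {e \<in> F. e \<subseteq> X})" for X
  have "\<forall>e\<in>F1. \<exists>X. X \<in> p3s E \<and> e \<subseteq> X \<and> (\<exists>a b c. e = {a, c} \<and> X = {a, b, c} \<and> {a, b} \<in> E \<and> {b, c} \<in> E)"
  proof
    fix e assume "e \<in> F1"
    then obtain a b c where abc: "e \<in> F" "e = {a, c}" "{a, b} \<in> E" "{b, c} \<in> E"
      by (auto simp: F1_def)
    then show "\<exists>X. X \<in> p3s E \<and> e \<subseteq> X \<and>
        (\<exists>a b c. e = {a, c} \<and> X = {a, b, c} \<and> {a, b} \<in> E \<and> {b, c} \<in> E)"
      using FD by (intro exI[of _ "{a, b, c}"] conjI p3sI) auto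
  qed
  then obtain f where f: "\<And>e. e \<in> F1 \<Longrightarrow> f e \<in> p3s E \<and> e \<subseteq> f e \<and>
      (\<exists>a b c. e = {a, c} \<and> f e = {a, b, c} \<and> {a, b} \<in> E \<and> {b, c} \<in> E)"
    by metis
  define X0 where "X0 = \<Union>(f ` F1)"
  have F1X0: "e \<subseteq> X0" if "e \<in> F1" for e using f[OF that] that by (auto simp: X0_def)
  have finF1: "finite F1" using finF by (simp add: F1_def)
  have "card (f ` F1) \<le> card F1" using finF1 by (rule card_image_le)
  also have "\<dots> \<le> card {e \<in> F. e \<subseteq> X0}"
    by (rule card_mono) (use finF F1X0 in \<open>auto simp: F1_def\<close>)
  finally have "good X0"
    unfolding good_def X0_def
    using f by (intro conjI exI[of _ "f ` F1"] UN_least p3s_subset) auto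
  moreover have "finite {X. good X}"
    by (rule finite_subset[of _ "Pow U"]) (auto simp: good_def fin)
  ultimately obtain X where X: "good X" "X0 \<subseteq> X" and max: "\<And>Y. good Y \<Longrightarrow> X \<subseteq> Y \<Longrightarrow> Y = X"
    using finite_has_maximal2[of "{X. good X}" X0] by auto
  have XV: "X \<subseteq> U" using X by (simp add: good_def)
  \<comment> \<open>Maximality of \<open>X\<close> as an accounting rule: vertices whose covering
    paths \<open>Q\<close> are paid for by new edges \<open>G\<close> of \<open>F\<close> already
    belong to \<open>X\<close>.\<close>
  have ext: "Y \<subseteq> X"
    if Y: "Y \<subseteq> U" and Q: "Q \<subseteq> p3s E" "Y \<subseteq> \<Union>Q \<union> X"
      and G: "G \<subseteq> F" "\<And>e. e \<in> G \<Longrightarrow> e \<subseteq> X \<union> Y \<and> \<not> e \<subseteq> X" and le: "card Q \<le> card G" for Y Q G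
  proof -
    obtain P where P: "P \<subseteq> p3s E" "X \<subseteq> \<Union>P" "card P \<le> card {e \<in> F. e \<subseteq> X}"
      using X by (auto simp: good_def)
    have "card (P \<union> Q) \<le> card P + card Q" by (rule card_Un_le)
    also have "\<dots> \<le> card {e \<in> F. e \<subseteq> X} + card G" using P le by simp
    also have "\<dots> = card ({e \<in> F. e \<subseteq> X} \<union> G)"
      by (rule card_Un_disjoint[symmetric]) (use finF G finite_subset in auto)
    also have "\<dots> \<le> card {e \<in> F. e \<subseteq> X \<union> Y}"
      by (rule card_mono) (use finF G in auto)
    finally have "good (X \<union> Y)"
      unfolding good_def using P Q Y XV by (intro conjI exI[of _ "P \<union> Q"]) auto
    then show ?thesis using max by blast
  qed
  have out: "b \<notin> X" if "{a, b} \<in> F" "a \<notin> X" for a b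
  proof
    assume "b \<in> X"
    have "a \<in> U" using FD[OF that(1)] by blast
    then obtain Z where "Z \<in> p3s E" "a \<in> Z" using vertex_in_p3 by blast
    then have "{a} \<subseteq> X"
      using that FD \<open>b \<in> X\<close> by (intro ext[of "{a}" "{Z}" "{{a, b}}"]) auto
    then show False using that by simp
  qed
  have F1_in: "a \<in> X" if "{a, b} \<in> F1" for a b
    using F1X0[OF that] X by auto
  \<comment> \<open>A triangle outside \<open>X\<close> with two edges of \<open>F\<close> at
    \<open>b\<close> pays for itself: if its third edge is in \<open>F\<close>, three edges pay for
    three paths; if it is in \<open>E\<close>, one path contains it and two paths suffice.\<close>
  have two: False
    if "{b, u} \<in> F" "{b, a} \<in> F" "{a, u} \<in> E \<union> F" "u \<notin> X" "b \<notin> X" "a \<notin> X" "u \<noteq> a" for u a b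
  proof -
    have U: "u \<in> U" "a \<in> U" "b \<in> U" "b \<noteq> u" "b \<noteq> a" using FD[OF that(1)] FD[OF that(2)] by auto
    obtain Za Zb Zu where Z: "Za \<in> p3s E" "a \<in> Za" "Zb \<in> p3s E" "b \<in> Zb" "Zu \<in> p3s E" "u \<in> Zu"
      using vertex_in_p3 U by metis
    show False
    proof (cases "{a, u} \<in> F")
      case True
      have "card {Za, Zb, Zu} \<le> 3" by (simp add: card_insert_if)
      also have "3 = card {{b, u}, {b, a}, {a, u}}"
        using U that by (simp add: doubleton_eq_iff)
      finally have "{a, b, u} \<subseteq> X"
        using True that Z U
        by (intro ext[of "{a, b, u}" "{Za, Zb, Zu}" "{{b, u}, {b, a}, {a, u}}"]) auto
      then show False using that by simp
    next
      case False
      then have "{a, u} \<in> E" using that(3) by blast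
      then obtain Z' where Z': "Z' \<in> p3s E" "{a, u} \<subseteq> Z'" using edge_in_p3 by blast
      have "card {Z', Zb} \<le> 2" by (simp add: card_insert_if)
      also have "2 = card {{b, u}, {b, a}}"
        using U that by (simp add: doubleton_eq_iff)
      finally have "{a, b, u} \<subseteq> X"
        using that Z U Z'
        by (intro ext[of "{a, b, u}" "{Z', Zb}" "{{b, u}, {b, a}}"]) auto
      then show False using that by simp
    qed
  qed
  have tri_out: False
    if u: "u \<notin> X" and ub: "{u, b} \<in> F" and ua: "{u, a} \<in> E \<union> F" and ab: "{a, b} \<in> E \<union> F"
      and ne: "u \<noteq> a" "u \<noteq> b" "a \<noteq> b" for u a b
  proof -
    have b: "b \<notin> X" using out ub u by blast
    show False
    proof (cases "{u, a} \<in> F")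
      case True
      then have "a \<notin> X" using out u by blast
      then show False using two[of u b a] True ub ab u b ne by (auto simp: insert_commute)
    next
      case False
      then have uaE: "{a, u} \<in> E" using ua by (auto simp: insert_commute)
      have "{a, b} \<notin> E"
      proof
        assume "{a, b} \<in> E"
        then have "{u, a} \<in> E" "{a, b} \<in> E" using uaE by (simp_all add: insert_commute)
        then have "{u, b} \<in> F1" using ub unfolding F1_def by blast
        then show False using F1_in u by blast
      qed
      then have abF: "{b, a} \<in> F" using ab by (auto simp: insert_commute)
      then have "a \<notin> X" using out b by blast
      then show False using two[of b u a] ub abF uaE u b ne by (auto simp: insert_commute)
    qed
  qed
  have "U \<subseteq> X"
  proof (rule ccontr)
    assume "\<not> U \<subseteq> X"
    then obtain u where u: "u \<in> U" "u \<notin> X" by blast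
    obtain a b where t: "u \<noteq> a" "u \<noteq> b" "a \<noteq> b" "{u, a} \<in> E \<union> F" "{u, b} \<in> E \<union> F" "{a, b} \<in> E \<union> F"
      using tri[OF u(1)] by (auto simp: in_triangle_def)
    consider "{u, b} \<in> F" | "{u, a} \<in> F" | "{a, u} \<in> E" "{u, b} \<in> E"
      using t by (auto simp: insert_commute)
    then show False
    proof cases
      case 1
      then show False using tri_out[of u b a] t u by blast
    next
      case 2
      then show False using tri_out[of u a b] t u by (auto simp: insert_commute)
    next
      case 3
      then have "{a, b} \<notin> E" using no_triangle by blast
      then have abF: "{a, b} \<in> F" using t by auto
      then have ab: "{a, b} \<in> F1" using 3 unfolding F1_def by blast
      obtain x y z where xyz: "{a, b} = {x, z}" "f {a, b} = {x, y, z}" "{x, y} \<in> E" "{y, z} \<in> E"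
        using f[OF ab] by auto
      have ay: "{a, y} \<in> E" "{y, b} \<in> E"
        using xyz by (auto simp: doubleton_eq_iff insert_commute)
      \<comment> \<open>The path picked for \<open>{a, b}\<close> has the middle vertex
        \<open>u\<close>, since a second middle vertex would close a 4-cycle.\<close>
      have "y = u"
      proof (rule ccontr)
        assume "y \<noteq> u"
        then have "graph_cycle E [a, y, b, u]"
          using ay 3 t edgeD[OF ay(1)] edgeD[OF ay(2)] 
          by (auto simp: graph_cycle_def less_Suc_eq insert_commute)
        then show False using acyc by blast
      qed
      then have "u \<in> X0" using ab xyz by (auto simp: X0_def)
      then show False using u X by blast
    qed
  qed
  then have "X = U" using XV by blast
  moreover obtain P where P: "P \<subseteq> p3s E" "X \<subseteq> \<Union>P" "card P \<le> card {e \<in> F. e \<subseteq> X}"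
    using X(1) by (auto simp: good_def)
  moreover have "card {e \<in> F. e \<subseteq> X} \<le> card F"
    using finF by (intro card_mono) auto
  ultimately show ?thesis
    unfolding p3_cover_def by (intro exI[of _ P]) simp
qed

text \<open>A path \<open>X\<close> of the extended cover that contains the uncovered
  \<open>w\<close> is not in \<open>M\<close>. All its vertices lie in \<open>Q\<close> or in paths
  of \<open>M\<close>, so it can be swapped for \<open>Q\<close>.\<close>

lemma extendable_insert:
  assumes M: "extendable U E M" and Q: "Q \<in> p3s E" and w: "w \<in> U" "w \<notin> \<Union>M"
    and sub: "\<And>X. X \<in> p3s E \<Longrightarrow> w \<in> X \<Longrightarrow> X \<subseteq> Q \<union> \<Union>M"
  shows "extendable U E (insert Q M)"
  unfolding extendable_def
proof (intro conjI allI impI)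
  show "insert Q M \<subseteq> p3s E" using M Q by (auto simp: extendable_def)
  fix P assume "p3_cover U E P"
  then obtain P' where P': "p3_cover U E P'" "M \<subseteq> P'" "card P' \<le> card P"
    using M by (auto simp: extendable_def)
  then obtain X where X: "X \<in> P'" "w \<in> X" using w by (auto simp: p3_cover_def)
  have fP: "finite P'" using P' finite_p3s by (auto simp: p3_cover_def)
  have "X \<notin> M" using X w by auto
  let ?P = "insert Q (P' - {X})"
  have "X \<subseteq> Q \<union> \<Union>M" using sub X P' by (auto simp: p3_cover_def)
  then have "p3_cover U E ?P" "insert Q M \<subseteq> ?P"
    using P' Q \<open>X \<notin> M\<close> by (auto simp: p3_cover_def, blast+)
  moreover have "card ?P \<le> card P'"
    using X fP by (simp add: card_insert_remove1_le)
  ultimately show "\<exists>P'. p3_cover U E P' \<and> insert Q M \<subseteq> P' \<and> card P' \<le> card P"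
    using P' by (meson order_trans)
qed

text \<open>Two different paths \<open>X\<close> and \<open>X'\<close> covering \<open>u\<close> and \<open>u'\<close> contribute at most one further
  neighbour of \<open>p\<close> each, so they can be exchanged for \<open>{u, p, u'}\<close> and the path through these two
  neighbours.\<close>

lemma extendable_insert_siblings:
  assumes M: "extendable U E M" and up: "{u, p} \<in> E" and up': "{u', p} \<in> E" and ne: "u \<noteq> u'"
    and un: "u \<notin> \<Union>M" and un': "u' \<notin> \<Union>M"
    and sub: "\<And>X. X \<in> p3s E \<Longrightarrow> u \<in> X \<Longrightarrow> \<exists>x. {p, x} \<in> E \<and> X \<subseteq> {u, p, x} \<union> \<Union>M"
    and sub': "\<And>X. X \<in> p3s E \<Longrightarrow> u' \<in> X \<Longrightarrow> \<exists>x. {p, x} \<in> E \<and> X \<subseteq> {u', p, x} \<union> \<Union>M"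
  shows "extendable U E (insert {u, p, u'} M)"
  unfolding extendable_def
proof (intro conjI allI impI)
  let ?Q = "{u, p, u'}"
  have Q: "?Q \<in> p3s E" using up up' ne by (intro p3sI) (auto simp: insert_commute)
  show "insert ?Q M \<subseteq> p3s E" using M Q by (auto simp: extendable_def)
  have nep: "u \<noteq> p" "u' \<noteq> p" using edgeD up up' by auto
  fix P assume "p3_cover U E P"
  then obtain P' where P': "p3_cover U E P'" "M \<subseteq> P'" "card P' \<le> card P"
    using M by (auto simp: extendable_def)
  have uV: "u \<in> U" "u' \<in> U" using edgeD up up' by auto
  obtain X X' where X: "X \<in> P'" "u \<in> X" "X' \<in> P'" "u' \<in> X'"
    using P'(1) uV unfolding p3_cover_def by (meson UnionE subsetD)
  then have X3: "X \<in> p3s E" "X' \<in> p3s E" using P' by (auto simp: p3_cover_def)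
  have XM: "X \<notin> M" "X' \<notin> M" using X un un' by auto
  have fP: "finite P'" using P' finite_p3s by (auto simp: p3_cover_def)
  obtain x where x: "{p, x} \<in> E" "X \<subseteq> {u, p, x} \<union> \<Union>M" using sub X3 X by blast
  obtain x' where x': "{p, x'} \<in> E" "X' \<subseteq> {u', p, x'} \<union> \<Union>M" using sub' X3 X by blast
  have "\<exists>P''. p3_cover U E P'' \<and> insert ?Q M \<subseteq> P'' \<and> card P'' \<le> card P'"
  \<comment> \<open>If one path covers both siblings, its vertices lie in \<open>?Q\<close> or in
    paths of \<open>M\<close>, and a single swap suffices.\<close>
  proof (cases "X = X'")
    case True
    then have "x = u'" using x X ne nep un' by auto
    then have "X \<subseteq> ?Q \<union> \<Union>M" using x by blast
    then have "p3_cover U E (insert ?Q (P' - {X}))" "insert ?Q M \<subseteq> insert ?Q (P' - {X})"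
      using P' Q XM by (auto simp: p3_cover_def, blast+)
    moreover have "card (insert ?Q (P' - {X})) \<le> card P'"
      using X fP by (simp add: card_insert_remove1_le)
    ultimately show ?thesis by blast
  next
    case False
    \<comment> \<open>\<open>Z\<close> takes over the further neighbours of \<open>p\<close>; if
      they coincide, one path containing that neighbour will do.\<close>
    obtain Z where Z: "Z \<in> p3s E" "{x, x'} \<subseteq> ?Q \<union> Z"
    proof (cases "x = x'")
      case True
      then show ?thesis
        using that[of ?Q] that[of "{u, p, x}"] Q p3sI[of u p E x] up x by (cases "x = u") auto
    next
      case False
      then show ?thesis
        using that[of "{x, p, x'}"] p3sI[of x p E x'] x x' by (auto simp: insert_commute)
    qed
    let ?P = "insert ?Q (insert Z (P' - {X, X'}))"
    have "X \<union> X' \<subseteq> ?Q \<union> Z \<union> \<Union>M" using x x' Z by blast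
    moreover have sub: "M \<subseteq> P' - {X, X'}" using XM P' by auto
    ultimately have "p3_cover U E ({?Q, Z} \<union> (P' - {X, X'}))"
      using Q Z by (intro p3_cover_exchange[OF P'(1)]) auto
    then have "p3_cover U E ?P" by simp
    moreover have "insert ?Q M \<subseteq> ?P" using sub by blast
    moreover have "card ?P \<le> card P'" using card_insert2_remove2_le[OF fP X(1) X(3) False] .
    ultimately show ?thesis by blast
  qed
  then show "\<exists>P'. p3_cover U E P' \<and> insert ?Q M \<subseteq> P' \<and> card P' \<le> card P"
    using P' by (meson order_trans)
qed

end

definition path3 :: "'a set set \<Rightarrow> 'a \<Rightarrow> 'a \<Rightarrow> 'a \<Rightarrow> bool" where
  "path3 E a b c \<longleftrightarrow> {a, b} \<in> E \<and> {b, c} \<in> E \<and> a \<noteq> c"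

text \<open>The paths in \<open>M\<close> are recorded by their end points only.\<close>

definition records :: "'a set set \<Rightarrow> (nat \<Rightarrow> 'a) \<Rightarrow> (nat \<Rightarrow> 'a) \<Rightarrow> nat \<Rightarrow> 'a set set \<Rightarrow> bool" where
  "records E f g k M \<longleftrightarrow> finite M \<and> card M = k \<and> (\<forall>i<k. \<exists>b. path3 E (f i) b (g i)) \<and>
     (\<forall>X\<in>M. \<exists>i<k. \<exists>b. path3 E (f i) b (g i) \<and> X = {f i, b, g i})"

lemma records_insert:
  assumes "records E f g k M" "path3 E a b c" "{a, b, c} \<notin> M"
  shows "records E (f(k := a)) (g(k := c)) (Suc k) (insert {a, b, c} M)"
  using assms unfolding records_def by (auto simp: less_Suc_eq; metis less_irrefl_nat)

section \<open>Removing leaves\<close>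

text \<open>The removed part is a forest of rooted subtrees hanging off the connected rest, with
  \<open>par\<close> pointing towards the rest.\<close>

definition peeled :: "'a set \<Rightarrow> 'a set set \<Rightarrow> 'a set \<Rightarrow> ('a \<Rightarrow> 'a) \<Rightarrow> bool" where
  "peeled U E D par \<longleftrightarrow> D \<subseteq> U \<and> cut_connected (U - D) E \<and>
     (\<forall>v\<in>D. {v, par v} \<in> E \<and> (\<forall>z. {v, z} \<in> E \<longrightarrow> z \<noteq> par v \<longrightarrow> z \<in> D \<and> par z = v))"

definition waiting :: "'a set \<Rightarrow> ('a \<Rightarrow> 'a) \<Rightarrow> 'a set set \<Rightarrow> 'a \<Rightarrow> 'a set" where
  "waiting D par M p = {v \<in> D. par v = p \<and> v \<notin> \<Union>M}"

text \<open>An uncovered removed vertex can still be reached through its remaining parent. That at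
  most one child waits at each remaining vertex is kept separately, in \<open>marks\<close>.\<close>

definition greedy :: "'a set \<Rightarrow> 'a set set \<Rightarrow> 'a set \<Rightarrow> ('a \<Rightarrow> 'a) \<Rightarrow> 'a set set \<Rightarrow> bool" where
  "greedy U E D par M \<longleftrightarrow> peeled U E D par \<and> extendable U E M \<and> (\<forall>v\<in>D. v \<notin> \<Union>M \<longrightarrow> par v \<notin> D)"

context big_tree
begin

lemma completion_of_records:
  assumes M: "extendable U E M" and cov: "U \<subseteq> \<Union>M" and rec: "records E f g k M"
  defines "F \<equiv> (\<lambda>i. {f i, g i}) ` {..<k}"
  shows "bij_betw (\<lambda>i. {f i, g i}) {..<k} F \<and> min_triangle_completion U E F"
proof -
  have k: "card M = k" and path: "\<And>i. i < k \<Longrightarrow> \<exists>b. path3 E (f i) b (g i)"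
    and rep: "\<And>X. X \<in> M \<Longrightarrow> \<exists>i<k. \<exists>b. path3 E (f i) b (g i) \<and> X = {f i, b, g i}"
    using rec by (auto simp: records_def)
  \<comment> \<open>A completion is traded for a cover, and \<open>M\<close> extends to a cover of
    no larger size.\<close>
  have lower: "k \<le> card F'" if F': "triangle_completion U E F'" for F'
  proof -
    obtain P where P: "p3_cover U E P" "card P \<le> card F'"
      using p3_cover_of_completion[OF F'] by blast
    then obtain P' where P': "p3_cover U E P'" "M \<subseteq> P'" "card P' \<le> card P"
      using M unfolding extendable_def by blast
    then have "card M \<le> card P'" using finite_p3s by (auto simp: p3_cover_def intro: card_mono)
    then show ?thesis using P P' k by simp
  qed
  have "F \<subseteq> non_loops U - E"
  proof
    fix e assume "e \<in> F"
    then obtain i where i: "e = {f i, g i}" "i < k" by (auto simp: F_def)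
    then obtain b where "path3 E (f i) b (g i)" using path by blast
    then have "f i \<in> U" "g i \<in> U" "f i \<noteq> g i" "{f i, g i} \<notin> E"
      using edgeD[of "f i" b] edgeD[of b "g i"] no_triangle[of "f i" b "g i"]
      by (auto simp: path3_def)
    then show "e \<in> non_loops U - E" using i by (auto simp: non_loops_def)
  qed
  moreover have "in_triangle (E \<union> F) v" if v: "v \<in> U" for v
  proof -
    obtain X where X: "X \<in> M" "v \<in> X" using v cov by blast
    then obtain i b where i: "i < k" "path3 E (f i) b (g i)" "X = {f i, b, g i}"
      using rep by blast
    define a c where "a = f i" and "c = g i"
    have F: "{a, c} \<in> F" "{c, a} \<in> F" using i by (auto simp: F_def a_def c_def insert_commute)
    have p: "{a, b} \<in> E" "{b, c} \<in> E" "{b, a} \<in> E" "{c, b} \<in> E" "a \<noteq> c" "a \<noteq> b" "b \<noteq> c"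
      using i edgeD by (auto simp: path3_def a_def c_def insert_commute)
    have "v = a \<or> v = b \<or> v = c" using X i by (auto simp: a_def c_def)
    then show ?thesis 
    proof (elim disjE)
      assume "v = a"
      then show ?thesis unfolding in_triangle_def using F p by (intro exI[of _ b] exI[of _ c]) simp
    next
      assume "v = b"
      then show ?thesis unfolding in_triangle_def using F p by (intro exI[of _ a] exI[of _ c]) simp
    next
      assume "v = c"
      then show ?thesis unfolding in_triangle_def using F p by (intro exI[of _ a] exI[of _ b]) auto
    qed
  qed
  ultimately have comp: "triangle_completion U E F" by (simp add: triangle_completion_def)
  have "card F \<le> k" unfolding F_def by (metis card_image_le card_lessThan finite_lessThan)
  then have "card F = card {..<k}" using lower[OF comp] by simp
  \<comment> \<open>Counting alone shows that no pair of end points repeats: otherwise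
    \<open>F\<close> would be a completion smaller than the lower bound \<open>k\<close>.\<close>
  then have "inj_on (\<lambda>i. {f i, g i}) {..<k}" unfolding F_def by (intro eq_card_imp_inj_on) auto
  then have "bij_betw (\<lambda>i. {f i, g i}) {..<k} F" by (simp add: bij_betw_def F_def)
  moreover have "card F \<le> card F'" if "triangle_completion U E F'" for F'
    using lower[OF that] \<open>card F \<le> k\<close> by simp
  ultimately show ?thesis using comp by (simp add: min_triangle_completion_def)
qed

text \<open>By acyclicity some remaining vertex has degree at most 1, hence 0, and by connectivity
  it is alone.\<close>

lemma peeled_last:
  assumes "peeled U E D par" and r: "r \<in> U - D"
    and deg: "\<And>x. x \<in> U - D \<Longrightarrow> card (nbrs E x \<inter> (U - D)) \<noteq> 1"
  shows "U - D = {r}"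
proof -
  let ?R = "U - D"
  have conn: "cut_connected ?R E" using assms by (simp add: peeled_def)
  define E' where "E' = {e \<in> E. e \<subseteq> ?R}"
  have "E' \<subseteq> non_loops ?R" 
  proof
    fix e assume "e \<in> E'"
    then obtain x y where "e = {x, y}" "x \<noteq> y" "{x, y} \<subseteq> ?R"
      using edges by (auto simp: E'_def non_loops_def)
    then show "e \<in> non_loops ?R" by (auto simp: non_loops_def)
  qed
  moreover have "\<not> (\<exists>p. graph_cycle E' p)"
    using acyc graph_cycle_mono[of E' _ E] by (auto simp: E'_def)
  ultimately obtain x where x: "x \<in> ?R" "card (nbrs E' x) \<le> 1"
    using acyclic_low_degree[of ?R E'] fin r by auto
  have "nbrs E' x = nbrs E x \<inter> ?R" using x(1) by (auto simp: nbrs_def E'_def)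
  then have "card (nbrs E x \<inter> ?R) = 0" using x deg[of x] by (metis le_antisym less_one not_le)
  then have "nbrs E x \<inter> ?R = {}" using fin by simp
  then have "?R = {x}"
    using cut_connectedD[OF conn, of "{x}"] x(1) by (auto simp: nbrs_def)
  then show ?thesis using r by auto
qed

text \<open>Every neighbour of the leaf \<open>u\<close> other than \<open>p\<close> is already
  removed; as its neighbour \<open>u\<close> was still remaining, \<open>u\<close> must be its
  parent.\<close>

lemma peeled_insert:
  assumes P: "peeled U E D par" and u: "u \<in> U - D" and p: "nbrs E u \<inter> (U - D) = {p}"
  shows "peeled U E (insert u D) (par(u := p))"
proof -
  have nb: "z \<in> D \<and> par z = u" if "{u, z} \<in> E" "z \<noteq> p" for z
    using that p u P edgeD[of u z] unfolding peeled_def nbrs_def by (force simp: insert_commute)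
  have "U - insert u D = U - D - {u}" by blast
  then have "cut_connected (U - insert u D) E"
    using cut_connected_remove_leaf[OF _ p] P by (simp add: peeled_def)
  moreover have "{u, p} \<in> E" using p by (auto simp: nbrs_def)
  moreover have "{v, (par(u := p)) v} \<in> E \<and>
      (\<forall>z. {v, z} \<in> E \<longrightarrow> z \<noteq> (par(u := p)) v \<longrightarrow> z \<in> insert u D \<and> (par(u := p)) z = v)"
    if v: "v \<in> insert u D" for v
  proof (cases "v = u")
    case True
    then show ?thesis using nb calculation(2) edgeD[of u u] by auto
  next
    case False
    then have "v \<in> D" using v by simp
    then have "{v, par v} \<in> E" "\<And>z. {v, z} \<in> E \<Longrightarrow> z \<noteq> par v \<Longrightarrow> z \<in> D \<and> par z = v"
      using P unfolding peeled_def by blast+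
    then show ?thesis using False u by (metis DiffD2 fun_upd_apply insertCI)
  qed
  moreover have "insert u D \<subseteq> U" using P u by (auto simp: peeled_def)
  ultimately show ?thesis unfolding peeled_def by blast
qed

text \<open>Everything below \<open>v\<close> is covered, so a path through \<open>v\<close> gains
  at most \<open>v\<close>, \<open>par v\<close> and one more neighbour of \<open>par v\<close>. In
  \<open>cov\<close> the children of \<open>par v\<close> are exempt, because \<open>v\<close>
  itself may be uncovered while its parent is removed.\<close>

lemma p3_at_peeled:
  assumes P: "peeled U E D par" and v: "v \<in> D"
    and cov: "\<And>z. z \<in> D \<Longrightarrow> par z \<in> D \<Longrightarrow> par z \<noteq> par v \<Longrightarrow> z \<in> \<Union>M"
    and X: "X \<in> p3s E" "v \<in> X"
  shows "\<exists>x. {par v, x} \<in> E \<and> X \<subseteq> {v, par v, x} \<union> \<Union>M"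
proof -
  have pv: "{par v, v} \<in> E" "par v \<noteq> v"
  proof -
    have "{v, par v} \<in> E" using P v by (simp add: peeled_def)
    then show "{par v, v} \<in> E" "par v \<noteq> v" using edgeD[of v "par v"] by (auto simp: insert_commute)
  qed
  have child: "y \<in> D \<and> par y = x" if "{x, y} \<in> E" "y \<noteq> par x" "x \<in> D" for x y
    using P that unfolding peeled_def by blast
  have nb: "y \<in> D \<and> par y = v \<and> y \<in> \<Union>M" if "{v, y} \<in> E" "y \<noteq> par v" for y
    using child[OF that v] cov[of y] pv v by auto
  have nb2: "z \<in> \<Union>M" if "{v, y} \<in> E" "y \<noteq> par v" "{y, z} \<in> E" "z \<noteq> v" for y z
    using nb[OF that(1,2)] child[of y z] cov[of z] that by auto
  have "\<exists>x. {par v, x} \<in> E \<and> {v, b, c} \<subseteq> {v, par v, x} \<union> \<Union>M"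
    if "{v, b} \<in> E" "{b, c} \<in> E" "v \<noteq> c" for b c
  proof (cases "b = par v")
    case True
    then show ?thesis using that by (intro exI[of _ c]) auto
  next
    case False
    \<comment> \<open>No further neighbour of \<open>par v\<close> occurs here, and \<open>v\<close>
      serves as a filler for it.\<close>
    then show ?thesis using that nb[of b] nb2[of b c] pv by (intro exI[of _ v]) auto
  qed
  note ends = this
  obtain a b c where abc: "X = {a, b, c}" "{a, b} \<in> E" "{b, c} \<in> E" "a \<noteq> c"
    using X by (auto simp: p3s_def)
  consider "v = a" | "v = b" | "v = c" using abc X by auto
  then show ?thesis
  proof cases
    case 1
    then show ?thesis using ends[of b c] abc by simp
  next
    case 2
    have "a \<in> {v, par v, v} \<union> \<Union>M" "c \<in> {v, par v, v} \<union> \<Union>M"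
      using nb[of a] nb[of c] abc 2 by (auto simp: insert_commute)
    then show ?thesis using abc(1) 2 pv by (intro exI[of _ v]) simp
  next
    case 3
    then show ?thesis using ends[of b a] abc by (simp add: insert_commute)
  qed
qed

context
  fixes D par M u p D' par'
  assumes G: "greedy U E D par M" and u: "u \<in> U - D" and p: "nbrs E u \<inter> (U - D) = {p}"
  defines "D' \<equiv> insert u D" and "par' \<equiv> par(u := p)"
begin

lemma step_facts:
  "peeled U E D' par'" "extendable U E M" "p \<in> U - D'" "{u, p} \<in> E" "p \<noteq> u"
  "\<And>z. z \<in> D \<Longrightarrow> z \<notin> \<Union>M \<Longrightarrow> par z \<notin> D"
  "\<And>z. {u, z} \<in> E \<Longrightarrow> z \<noteq> p \<Longrightarrow> z \<in> D \<and> par z = u"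
  "\<And>z. z \<in> D \<Longrightarrow> {z, par z} \<in> E"
proof -
  show P': "peeled U E D' par'"
    using G peeled_insert[OF _ u p] by (auto simp: greedy_def D'_def par'_def)
  show "extendable U E M" "\<And>z. z \<in> D \<Longrightarrow> z \<notin> \<Union>M \<Longrightarrow> par z \<notin> D"
    "\<And>z. z \<in> D \<Longrightarrow> {z, par z} \<in> E"
    using G by (auto simp: greedy_def peeled_def)
  show up: "{u, p} \<in> E" using p by (auto simp: nbrs_def)
  show "p \<noteq> u" using edgeD[OF up] by blast
  then show "p \<in> U - D'" using p by (auto simp: D'_def)
  fix z assume "{u, z} \<in> E" "z \<noteq> p"
  then have "z \<in> D' \<and> par' z = u" "z \<noteq> u"
    using P' edgeD[of u z] by (auto simp: peeled_def D'_def par'_def)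
  then show "z \<in> D \<and> par z = u" by (auto simp: D'_def par'_def)
qed

text \<open>A path through \<open>w\<close> gains at most \<open>w\<close>, \<open>u\<close> and one
  more neighbour of \<open>u\<close>. The children of \<open>u\<close> other than \<open>w\<close>
  are covered, so \<open>p\<close> is the best third vertex.\<close>

lemma greedy_up:
  assumes w: "waiting D par M u = {w}"
  defines "M' \<equiv> insert {w, u, p} M"
  shows "greedy U E D' par' M'" "path3 E w u p" "{w, u, p} \<notin> M"
    "q \<notin> D' \<Longrightarrow> waiting D' par' M' q = waiting D par M q"
proof -
  note f = step_facts
  have wD: "w \<in> D" "par w = u" "w \<notin> \<Union>M" using w by (auto simp: waiting_def)
  have ne: "w \<noteq> u" "w \<noteq> p" using wD u f(3) by (auto simp: D'_def)
  then show path: "path3 E w u p" using f(4) f(8)[OF wD(1)] wD by (auto simp: path3_def)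
  show "{w, u, p} \<notin> M" using wD by auto
  have only: "z = w" if "z \<in> D" "par z = u" "z \<notin> \<Union>M" for z
    using w that by (auto simp: waiting_def)
  have "extendable U E M'"
    unfolding M'_def
  proof (rule extendable_insert[OF f(2), of _ w])
    show "{w, u, p} \<in> p3s E" using path by (auto simp: path3_def intro: p3sI)
    show "w \<in> U" using edgeD[OF f(8)[OF wD(1)]] by simp
    show "w \<notin> \<Union>M" by fact
    fix X assume X: "X \<in> p3s E" "w \<in> X"
    have "\<exists>x. {par' w, x} \<in> E \<and> X \<subseteq> {w, par' w, x} \<union> \<Union>M"
    proof (rule p3_at_peeled[OF f(1) _ _ X])
      show "w \<in> D'" using wD by (simp add: D'_def)
      fix z assume "z \<in> D'" "par' z \<in> D'" "par' z \<noteq> par' w"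
      then show "z \<in> \<Union>M" using f(3) f(6)[of z] wD ne by (auto simp: D'_def par'_def split: if_splits)
    qed
    then obtain x where x: "{u, x} \<in> E" "X \<subseteq> {w, u, x} \<union> \<Union>M" using ne wD by (auto simp: par'_def)
    have "x = p \<or> x = w \<or> x \<in> \<Union>M" using f(7)[OF x(1)] only by blast
    then show "X \<subseteq> {w, u, p} \<union> \<Union>M" using x by blast
  qed
  moreover have "par' v \<notin> D'" if "v \<in> D'" "v \<notin> \<Union>M'" for v
    using that only[of v] f(6)[of v] by (auto simp: D'_def par'_def M'_def)
  ultimately show "greedy U E D' par' M'" using f(1) by (simp add: greedy_def)
  show "waiting D' par' M' q = waiting D par M q" if "q \<notin> D'"
    using that ne wD f(3) u by (auto simp: waiting_def D'_def par'_def M'_def)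
qed

lemma greedy_skip:
  assumes w: "waiting D par M u = {}"
  shows "greedy U E D' par' M"
    "q \<notin> D' \<Longrightarrow> waiting D' par' M q = (if q = p \<and> u \<notin> \<Union>M then insert u else id) (waiting D par M q)"
proof -
  note f = step_facts
  have "par' v \<notin> D'" if "v \<in> D'" "v \<notin> \<Union>M" for v
    using that w f(6)[of v] f(3) by (auto simp: D'_def par'_def waiting_def)
  then show "greedy U E D' par' M" using f by (simp add: greedy_def)
  show "waiting D' par' M q = (if q = p \<and> u \<notin> \<Union>M then insert u else id) (waiting D par M q)"
    if "q \<notin> D'"
    using that u by (auto simp: waiting_def D'_def par'_def)
qed

text \<open>Both \<open>u\<close> and \<open>z\<close> are uncovered children of \<open>p\<close>
  with everything below them covered, the situation of
  \<open>extendable_insert_siblings\<close>.\<close>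

lemma greedy_pair:
  assumes w: "waiting D par M u = {}" and un: "u \<notin> \<Union>M" and z: "waiting D par M p = {z}"
  defines "M' \<equiv> insert {u, p, z} M"
  shows "greedy U E D' par' M'" "path3 E u p z" "{u, p, z} \<notin> M"
    "q \<notin> D' \<Longrightarrow> waiting D' par' M' q = (if q = p then {} else waiting D par M q)"
proof -
  note f = step_facts
  have zD: "z \<in> D" "par z = p" "z \<notin> \<Union>M" using z by (auto simp: waiting_def)
  have ne: "z \<noteq> u" "z \<noteq> p" using zD u f(3) by (auto simp: D'_def)
  have zp: "{z, p} \<in> E" using f(8) zD by auto
  then show "path3 E u p z" using f(4) ne by (auto simp: path3_def insert_commute)
  show "{u, p, z} \<notin> M" using zD by auto
  have c: "y \<in> \<Union>M" if "y \<in> D'" "par' y \<in> D'" for y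
    using that w f(3) f(6)[of y] by (auto simp: D'_def par'_def waiting_def split: if_splits)
  have "extendable U E M'"
    unfolding M'_def
  proof (rule extendable_insert_siblings[OF f(2) f(4) zp])
    show "\<exists>x. {p, x} \<in> E \<and> X \<subseteq> {u, p, x} \<union> \<Union>M" if "X \<in> p3s E" "u \<in> X" for X
      using p3_at_peeled[OF f(1) _ c that] by (auto simp: D'_def par'_def)
    show "\<exists>x. {p, x} \<in> E \<and> X \<subseteq> {z, p, x} \<union> \<Union>M" if "X \<in> p3s E" "z \<in> X" for X
      using p3_at_peeled[OF f(1) _ c that] zD ne by (auto simp: D'_def par'_def)
  qed (use ne un zD in auto)
  moreover have "par' v \<notin> D'" if "v \<in> D'" "v \<notin> \<Union>M'" for v
    using that c[of v] by (auto simp: M'_def)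
  ultimately show "greedy U E D' par' M'" using f(1) by (simp add: greedy_def)
  show "waiting D' par' M' q = (if q = p then {} else waiting D par M q)" if "q \<notin> D'"
    using that ne z f(3) u by (auto simp: waiting_def D'_def par'_def M'_def)
qed

end

lemma greedy_cover:
  assumes "greedy U E D par M" "U - D = {r}"
  shows "U \<subseteq> insert r (waiting D par M r) \<union> \<Union>M"
proof
  fix v assume v: "v \<in> U"
  show "v \<in> insert r (waiting D par M r) \<union> \<Union>M"
  proof (cases "v \<in> D \<and> v \<notin> \<Union>M")
    case True
    then have "par v \<notin> D" "{v, par v} \<in> E" using assms by (auto simp: greedy_def peeled_def)
    then have "par v = r" using edgeD assms by blast
    then show ?thesis using True by (simp add: waiting_def)
  next
    case False
    then show ?thesis using v assms by blast
  qed
qed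

text \<open>Since \<open>w\<close> is uncovered, a further path is unavoidable, and one that covers
  all the rest is as good as any.\<close>

lemma extendable_last:
  assumes M: "extendable U E M" and w: "w \<in> U" "w \<notin> \<Union>M" and Q: "path3 E a b c"
    and cov: "U \<subseteq> {a, b, c} \<union> \<Union>M"
  shows "extendable U E (insert {a, b, c} M)" "{a, b, c} \<notin> M"
proof -
  show "extendable U E (insert {a, b, c} M)"
    using Q p3s_subset cov by (intro extendable_insert[OF M _ w] p3sI) (auto simp: path3_def)
  show "{a, b, c} \<notin> M" using w cov by blast
qed

end

section \<open>Total correctness of programs\<close>

text \<open>A weakest precondition with running time: rewriting with \<open>ev_simps\<close>
  executes loop-free code symbolically.\<close>

definition ev :: "nat \<Rightarrow> com \<Rightarrow> state \<Rightarrow> (nat \<Rightarrow> state \<Rightarrow> bool) \<Rightarrow> bool" where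
  "ev W c \<sigma> Q \<longleftrightarrow> (\<exists>t \<sigma>'. exec W c \<sigma> t \<sigma>' \<and> Q t \<sigma>')"

lemma ev_Assign: "ev W (Assign x a) (s, A) Q \<longleftrightarrow> val a s \<le> W \<and> Q 1 (s(x := val a s), A)"
  unfolding ev_def by (rule iffI, fastforce elim: exec_elims(1), use exec.Assign in blast)

lemma ev_Add:
  "ev W (Add x a b) (s, A) Q \<longleftrightarrow> val a s + val b s \<le> W \<and> Q 1 (s(x := val a s + val b s), A)"
  unfolding ev_def by (rule iffI, fastforce elim: exec_elims(2), use exec.Add in blast)

lemma ev_Sub:
  "ev W (Sub x a b) (s, A) Q \<longleftrightarrow> val a s - val b s \<le> W \<and> Q 1 (s(x := val a s - val b s), A)"
  unfolding ev_def by (rule iffI, fastforce elim: exec_elims(3), use exec.Sub in blast)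

lemma ev_Load:
  "ev W (Load x r i) (s, A) Q \<longleftrightarrow>
     val i s \<le> W \<and> A r (val i s) \<le> W \<and> Q 1 (s(x := A r (val i s)), A)"
  unfolding ev_def by (rule iffI, fastforce elim: exec_elims(4), use exec.Load in blast)

lemma ev_Store:
  "ev W (Store r i a) (s, A) Q \<longleftrightarrow>
     val i s \<le> W \<and> val a s \<le> W \<and> Q 1 (s, A(r := (A r)(val i s := val a s)))"
  unfolding ev_def by (rule iffI, fastforce elim: exec_elims(5), use exec.Store in blast)

lemma ev_Seq: "ev W (Seq c1 c2) \<sigma> Q \<longleftrightarrow> ev W c1 \<sigma> (\<lambda>t \<sigma>'. ev W c2 \<sigma>' (\<lambda>t'. Q (t + t')))"
  unfolding ev_def by (fastforce intro: exec.Seq elim!: exec_elims(6))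

lemma ev_If:
  "ev W (If b c1 c2) \<sigma> Q \<longleftrightarrow> ev W (if holds b (fst \<sigma>) then c1 else c2) \<sigma> (\<lambda>t. Q (Suc t))"
  unfolding ev_def
proof -
  have eq: "exec W (If b c1 c2) \<sigma> t \<sigma>' \<longleftrightarrow>
      (\<exists>t'. t = Suc t' \<and> exec W (if holds b (fst \<sigma>) then c1 else c2) \<sigma> t' \<sigma>')" for t \<sigma>'
    by (auto intro: exec.IfTrue exec.IfFalse elim!: exec_elims(7))
  show "(\<exists>t \<sigma>'. exec W (If b c1 c2) \<sigma> t \<sigma>' \<and> Q t \<sigma>') =
      (\<exists>t \<sigma>'. exec W (if holds b (fst \<sigma>) then c1 else c2) \<sigma> t \<sigma>' \<and> Q (Suc t) \<sigma>')"
    unfolding eq by blast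
qed

lemmas ev_simps = ev_Assign ev_Add ev_Sub ev_Load ev_Store ev_Seq ev_If

lemma ev_mono: "ev W c \<sigma> P \<Longrightarrow> (\<And>t \<sigma>'. P t \<sigma>' \<Longrightarrow> Q t \<sigma>') \<Longrightarrow> ev W c \<sigma> Q"
  unfolding ev_def by blast

text \<open>The variant \<open>m\<close> bounds the number of rounds. Each costs at most
  \<open>K\<close> plus its test, and the last, failing test gives the \<open>+ 1\<close>.\<close>

lemma ev_While:
  assumes "I m \<sigma>"
    and body: "\<And>m \<sigma>. I m \<sigma> \<Longrightarrow> holds b (fst \<sigma>) \<Longrightarrow> ev W c \<sigma> (\<lambda>t \<sigma>'. t \<le> K \<and> (\<exists>m'<m. I m' \<sigma>'))"
  shows "ev W (While b c) \<sigma> (\<lambda>t \<sigma>'. t \<le> Suc K * m + 1 \<and> \<not> holds b (fst \<sigma>') \<and> (\<exists>m'. I m' \<sigma>'))"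
  using assms(1)
proof (induction m arbitrary: \<sigma> rule: less_induct)
  case (less m)
  show ?case
  proof (cases "holds b (fst \<sigma>)")
    case True
    obtain t \<sigma>' m' where 1: "exec W c \<sigma> t \<sigma>'" "t \<le> K" "m' < m" "I m' \<sigma>'"
      using body[OF less.prems True] by (auto simp: ev_def)
    obtain t' \<sigma>'' where 2: "exec W (While b c) \<sigma>' t' \<sigma>''" "t' \<le> Suc K * m' + 1"
        "\<not> holds b (fst \<sigma>'')" "\<exists>m. I m \<sigma>''"
      using less.IH[OF 1(3,4)] unfolding ev_def by blast
    have "Suc K * Suc m' \<le> Suc K * m" using 1(3) by (intro mult_le_mono) auto
    then have "Suc (t + t') \<le> Suc K * m + 1" using 1(2) 2(2) by simp
    then show ?thesis unfolding ev_def using exec.WhileTrue[OF True 1(1) 2(1)] 2(3,4) by blast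
  next
    case False
    then show ?thesis
      unfolding ev_def using exec.WhileFalse[OF False] less.prems
      by (intro exI[of _ 1] exI[of _ \<sigma>]) auto
  qed
qed

section \<open>The program\<close>

text \<open>Variables: 0 is \<open>n\<close>, 1 the number of edges stored in arrays 0 and 1, 2 the loop counter,
  3 the vertex under inspection, 7 and 8 the vertex removed last and its parent, 9 and 10 the
  vertex removed before and its parent, 4 to 6 scratch. Arrays, indexed by vertices: 2 holds the
  number and 3 the sum of the neighbours not yet removed, so that the parent of a leaf is read off
  array 3 without adjacency lists; 4 holds \<open>Suc w\<close> for the uncovered removed child \<open>w\<close> if there
  is one, else 0; 5 is 1 for covered vertices. Since the output is produced only after the input
  edges have been read, it overwrites them.\<close>

abbreviation seq (infixr ";;" 60) where "c1 ;; c2 \<equiv> Seq c1 c2"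

abbreviation "emit a b \<equiv> Store 0 (V 1) (V a) ;; Store 1 (V 1) (V b) ;; Add 1 (V 1) (N 1)"

definition add_neighbour :: "nat \<Rightarrow> nat \<Rightarrow> com" where
  "add_neighbour a b =
     Load 6 2 (V a) ;; Add 6 (V 6) (N 1) ;; Store 2 (V a) (V 6) ;;
     Load 6 3 (V a) ;; Add 6 (V 6) (V b) ;; Store 3 (V a) (V 6)"

definition read_edge :: com where
  "read_edge =
     Load 4 0 (V 2) ;; Load 5 1 (V 2) ;; add_neighbour 4 5 ;; add_neighbour 5 4 ;;
     Add 2 (V 2) (N 1)"

text \<open>Degree 0 is stored for a removed vertex so that it is never again taken for a leaf.
  \<open>Assign 4 (N 0)\<close> stands in for an empty command.\<close>

definition peel :: com where
  "peel =
     Load 4 2 (V 3) ;;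
     If (Equal (V 4) (N 1))
       (Load 5 3 (V 3) ;; Store 2 (V 3) (N 0) ;;
        Load 6 2 (V 5) ;; Sub 6 (V 6) (N 1) ;; Store 2 (V 5) (V 6) ;;
        Load 6 3 (V 5) ;; Sub 6 (V 6) (V 3) ;; Store 3 (V 5) (V 6) ;;
        Assign 9 (V 7) ;; Assign 10 (V 8) ;; Assign 7 (V 3) ;; Assign 8 (V 5) ;;
        Load 4 4 (V 3) ;; Load 6 5 (V 3) ;;
        If (Equal (V 4) (N 0))
          (If (Equal (V 6) (N 0))
             (Load 4 4 (V 5) ;;
              If (Equal (V 4) (N 0))
                (Add 4 (V 3) (N 1) ;; Store 4 (V 5) (V 4))
                (Sub 4 (V 4) (N 1) ;; Store 4 (V 5) (N 0) ;; emit 3 4 ;; Store 5 (V 5) (N 1)))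
             (Assign 4 (N 0)))
          (Sub 4 (V 4) (N 1) ;; emit 4 5 ;; Store 5 (V 5) (N 1)) ;;
        Assign 3 (V 5))
       (Add 2 (V 2) (N 1) ;; Assign 3 (V 2))"

text \<open>Register 8 holds the remaining vertex. If a last path is needed, it joins this vertex
  with the one removed last and, as third vertex, a waiting child different from these or else the
  vertex removed before.\<close>

definition finish :: com where
  "finish =
     Load 4 4 (V 8) ;; Load 5 5 (V 8) ;;
     If (Equal (V 4) (N 0))
       (If (Equal (V 5) (N 0))
          (If (Equal (V 10) (V 7)) (emit 9 8) (emit 9 7))
          (Assign 4 (N 0)))
       (Sub 4 (V 4) (N 1) ;;
        If (Equal (V 4) (V 7))
          (If (Equal (V 10) (V 7)) (emit 9 8) (emit 9 7))
          (emit 4 7))"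

definition complete_tree :: com where
  "complete_tree =
     While (Less (V 2) (V 1)) read_edge ;;
     Assign 1 (N 0) ;; Assign 2 (N 0) ;; Assign 3 (N 0) ;;
     While (Less (V 2) (V 0)) peel ;;
     finish"

section \<open>Invariants of the removal loop\<close>

definition counts :: "nat \<Rightarrow> nat set set \<Rightarrow> nat set \<Rightarrow> (nat \<Rightarrow> nat) \<Rightarrow> (nat \<Rightarrow> nat) \<Rightarrow> bool" where
  "counts n E D deg sm \<longleftrightarrow> (\<forall>x<n. if x \<in> D then deg x = 0
     else deg x = card (nbrs E x - D) \<and> sm x = \<Sum>(nbrs E x - D))"

text \<open>The case expression also asserts that at most one child waits at each remaining
  vertex.\<close>

definition marks ::
  "nat \<Rightarrow> nat set \<Rightarrow> (nat \<Rightarrow> nat) \<Rightarrow> nat set set \<Rightarrow> (nat \<Rightarrow> nat) \<Rightarrow> (nat \<Rightarrow> nat) \<Rightarrow> bool" where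
  "marks n D par M pend cov \<longleftrightarrow> (\<forall>x<n. x \<notin> D \<longrightarrow>
     waiting D par M x = (case pend x of 0 \<Rightarrow> {} | Suc w \<Rightarrow> {w}) \<and>
     cov x = (if x \<in> \<Union>M then 1 else 0))"

text \<open>\<open>x\<close> and \<open>y\<close> are the last and the last but one vertex removed. They form a path with the
  last remaining vertex.\<close>

definition recent ::
  "nat \<Rightarrow> nat set \<Rightarrow> (nat \<Rightarrow> nat) \<Rightarrow> nat \<Rightarrow> nat \<Rightarrow> nat \<Rightarrow> nat \<Rightarrow> bool" where
  "recent n D par x r y q \<longleftrightarrow> x < n \<and> r < n \<and> y < n \<and> q < n \<and>
     (D \<noteq> {} \<longrightarrow> x \<in> D \<and> par x = r \<and> r \<notin> D) \<and>
     (card D \<ge> 2 \<longrightarrow> y \<in> D \<and> y \<noteq> x \<and> par y = q \<and> (q = x \<or> q \<notin> D))"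

text \<open>Among the vertices up to \<open>v\<close> only the inspected \<open>u\<close> may be a
  leaf; at the end \<open>u = n\<close> is no vertex, so no leaf is left. The measure
  \<open>m\<close> drops with every counter increment and every removal.\<close>

definition scan :: "nat \<Rightarrow> nat set \<Rightarrow> nat \<Rightarrow> nat \<Rightarrow> nat \<Rightarrow> (nat \<Rightarrow> nat) \<Rightarrow> bool" where
  "scan n D m v u deg \<longleftrightarrow> v \<le> n \<and> (if v < n then u < n else u = n) \<and>
     (\<forall>x<n. x \<le> v \<longrightarrow> x \<noteq> u \<longrightarrow> deg x \<noteq> 1) \<and> m + v + card D = 2 * n"

fun peel_inv :: "nat \<Rightarrow> nat set set \<Rightarrow> nat \<Rightarrow> state \<Rightarrow> bool" where
  "peel_inv n E m (s, A) \<longleftrightarrow> (\<exists>D par M. greedy {..<n} E D par M \<and> {..<n} - D \<noteq> {} \<and>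
     s 0 = n \<and> records E (A 0) (A 1) (s 1) M \<and> s 1 \<le> card D \<and>
     counts n E D (A 2) (A 3) \<and> marks n D par M (A 4) (A 5) \<and>
     recent n D par (s 7) (s 8) (s 9) (s 10) \<and> scan n D m (s 2) (s 3) (A 2))"

declare peel_inv.simps [simp del]

section \<open>Correctness of the removal loop\<close>

locale ram_tree = big_tree "{..<n}" E for n :: nat and E +
  fixes W :: nat
  assumes W: "n * n \<le> W"
begin

lemma n3: "n \<ge> 3" using big by simp

lemma W_ge: "k \<le> 2 * n \<Longrightarrow> k \<le> W"
proof -
  have "2 * n \<le> n * n" using n3 by (intro mult_le_mono) auto
  then show "k \<le> 2 * n \<Longrightarrow> k \<le> W" using W by linarith
qed

lemma nbrs_sub: "nbrs E x \<subseteq> {..<n}" using edgeD by (auto simp: nbrs_def)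

lemma card_le_W: "S \<subseteq> {..<n} \<Longrightarrow> card S \<le> W"
  using card_mono[of "{..<n}" S] W_ge[of "card S"] by simp

text \<open>The sums of neighbours are what makes the word bound quadratic in \<open>n\<close>; all
  other stored numbers are linear.\<close>

lemma sum_le_W: assumes "S \<subseteq> {..<n}" shows "\<Sum>S \<le> W"
proof -
  have "\<Sum>S \<le> card S * n" using assms sum_bounded_above[of S "\<lambda>x. x" n] by fastforce
  also have "\<dots> \<le> n * n" using card_mono[of "{..<n}" S] assms by simp
  finally show ?thesis using W by simp
qed

lemma counts_peel:
  assumes c: "counts n E D deg sm" and D: "D \<subseteq> {..<n}" and u: "u < n" "deg u = 1"
  defines "p \<equiv> sm u"
  shows "u \<in> {..<n} - D" "nbrs E u \<inter> ({..<n} - D) = {p}"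
    "counts n E (insert u D) (deg(u := 0, p := deg p - Suc 0)) (sm(p := sm p - u))"
proof -
  show uD: "u \<in> {..<n} - D" using c u by (auto simp: counts_def split: if_splits)
  have "nbrs E x \<inter> ({..<n} - D) = nbrs E x - D" for x using nbrs_sub by blast
  moreover obtain q where q: "nbrs E u - D = {q}"
    using c u uD by (auto simp: counts_def card_1_singleton_iff)
  \<comment> \<open>The sum over a single remaining neighbour is that neighbour.\<close>
  moreover have "p = q" using c u uD q by (auto simp: counts_def p_def)
  ultimately show p: "nbrs E u \<inter> ({..<n} - D) = {p}" by simp
  have q: "nbrs E u - D = {p}" using q \<open>p = q\<close> by simp
  have sym: "y \<in> nbrs E x \<longleftrightarrow> x \<in> nbrs E y" for x y by (simp add: nbrs_def insert_commute)
  have pD: "p < n" "p \<notin> D" "u \<in> nbrs E p" "p \<noteq> u" 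
    using q sym[of p u] edgeD[of u p] by (auto simp: nbrs_def)
  have fin': "finite (nbrs E x)" for x using finite_subset nbrs_sub by blast
  have "nbrs E x - insert u D = nbrs E x - D" if "x \<noteq> p" "x \<notin> D" for x
    using q sym[of u x] that by blast
  moreover have "nbrs E p - D = insert u (nbrs E p - insert u D)" using pD uD by blast
  then have "card (nbrs E p - D) = Suc (card (nbrs E p - insert u D))"
    "\<Sum>(nbrs E p - D) = u + \<Sum>(nbrs E p - insert u D)"
    using fin' by (metis (no_types, lifting) DiffD2 card_insert_disjoint finite_Diff insertI1,
      metis (no_types, lifting) DiffD2 sum.insert finite_Diff insertI1)
  ultimately show "counts n E (insert u D) (deg(u := 0, p := deg p - Suc 0)) (sm(p := sm p - u))"
    using c pD uD by (auto simp: counts_def)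
qed

lemma peel_step:
  assumes "peel_inv n E m (s, A)" and v: "s 2 < s 0"
  shows "ev W peel (s, A) (\<lambda>t \<sigma>. t \<le> 30 \<and> (\<exists>m'<m. peel_inv n E m' \<sigma>))"
proof -
  obtain D par M where G: "greedy {..<n} E D par M" and ne: "{..<n} - D \<noteq> {}" and n: "s 0 = n"
    and rec: "records E (A 0) (A 1) (s 1) M" and k: "s 1 \<le> card D"
    and c: "counts n E D (A 2) (A 3)" and mk: "marks n D par M (A 4) (A 5)"
    and rc: "recent n D par (s 7) (s 8) (s 9) (s 10)" and sc: "scan n D m (s 2) (s 3) (A 2)"
    using assms by (auto simp: peel_inv.simps)
  define u where "u = s 3"
  have un: "u < n" using sc v n by (auto simp: scan_def u_def split: if_splits)
  have D: "D \<subseteq> {..<n}" using G by (auto simp: greedy_def peeled_def)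
  then have fD: "finite D" using finite_subset by blast
  have cD: "card D < n" using psubset_card_mono[of "{..<n}" D] D ne by auto
  have sW: "s 7 \<le> W" "s 8 \<le> W" "s 9 \<le> W" "s 10 \<le> W" "s 1 \<le> W" "s 2 \<le> W" "u \<le> W" "Suc (s 1) \<le> W"
    "Suc u \<le> W" "Suc (s 2) \<le> W"
    using rc k cD un v n by (auto simp: recent_def intro: W_ge)
  have c2: "A 2 x \<le> W" if "x < n" for x
    using c that nbrs_sub[of x] card_le_W[of "nbrs E x - D"] by (cases "x \<in> D") (auto simp: counts_def)
  show ?thesis
  proof (cases "A 2 u = 1")
    case False
    have "scan n D (m - 1) (Suc (s 2)) (Suc (s 2)) (A 2)" "m > 0"
      using sc False v n cD by (auto simp: scan_def u_def le_Suc_eq)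
    then have "peel_inv n E (m - 1) (s(4 := A 2 u, 2 := Suc (s 2), 3 := Suc (s 2)), A)" "m - 1 < m"
      using G ne n rec k c mk rc by (auto simp: peel_inv.simps)
    then show ?thesis
      using False sW c2[OF un] unfolding peel_def by (auto simp: ev_simps u_def[symmetric])
  next
    case True
    define p where "p = A 3 u"
    note cp = counts_peel[OF c D un True, folded p_def]
    note sf = step_facts[OF G cp(1,2)]
    define D' par' where "D' = insert u D" and "par' = par(u := p)"
    note sf = sf[folded D'_def par'_def]
    define deg' sm' where "deg' = (A 2)(u := 0, p := A 2 p - Suc 0)" and "sm' = (A 3)(p := A 3 p - u)"
    have pn: "p < n" "p \<notin> D'" "p \<notin> D" "p \<noteq> u" using sf(3,5) by (auto simp: D'_def)
    have uD: "u \<notin> D" using cp(1) by simp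
    have cD': "card D' = Suc (card D)" using uD fD by (simp add: D'_def)
    have ne': "{..<n} - D' \<noteq> {}" using pn by auto
    have c': "counts n E D' deg' sm'" using cp(3) by (simp add: deg'_def sm'_def D'_def)
    \<comment> \<open>The parent of the vertex removed before is either \<open>u\<close> itself or
      still remaining.\<close>
    have rc': "recent n D' par' u p (s 7) (s 8)"
      using rc pn un uD fD by (auto simp: recent_def D'_def par'_def)
    \<comment> \<open>Only the degree of \<open>p\<close> can drop to 1, and \<open>p\<close> is
      inspected next.\<close>
    have sc': "scan n D' (m - 1) (s 2) p deg'" and m: "m > 0"
      using sc v n pn cD cD' by (auto simp: scan_def deg'_def u_def)
    have "p \<le> W" "A 2 p - Suc 0 \<le> W" using pn c2[OF pn(1)] by (auto intro: W_ge)
    moreover have "nbrs E p - D \<subseteq> {..<n}" using nbrs_sub[of p] by blast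
    then have "A 3 p \<le> W" using c pn sum_le_W[of "nbrs E p - D"] by (auto simp: counts_def)
    moreover have "A 3 p - u \<le> W" using calculation by linarith
    moreover have cov: "A 5 u = (if u \<in> \<Union>M then 1 else 0)"
      and wu: "waiting D par M u = (case A 4 u of 0 \<Rightarrow> {} | Suc w \<Rightarrow> {w})"
      and wp: "waiting D par M p = (case A 4 p of 0 \<Rightarrow> {} | Suc w \<Rightarrow> {w})"
      using mk un uD pn unfolding marks_def by blast+
    moreover have "A 4 x \<le> W" if "x < n" "x \<notin> D" for x
    proof (cases "A 4 x")
      case (Suc w)
      then have "w \<in> D" using mk that by (force simp: marks_def waiting_def)
      then have "w < n" using D by blast
      then show ?thesis using Suc by (auto intro: W_ge)
    qed simp
    then have "A 4 u \<le> W" "A 4 p \<le> W" using un uD pn by auto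
    moreover have "1 \<le> W" using W_ge n3 by simp
    ultimately have bounds: "p \<le> W" "A 2 p - Suc 0 \<le> W" "A 3 p \<le> W" "A 3 p - u \<le> W"
      "A 4 u \<le> W" "A 4 p \<le> W" "A 5 u \<le> W" "Suc 0 \<le> W" "A 2 u \<le> W" "A 2 p \<le> W" "A 3 u \<le> W"
      using c2 un pn by (auto simp: p_def)
    have new: "peel_inv n E (m - 1) (s', A')"
      if "greedy {..<n} E D' par' M'" "s' 0 = n" "records E (A' 0) (A' 1) (s' 1) M'"
        "s' 1 \<le> Suc (card D)" "A' 2 = deg'" "A' 3 = sm'" "marks n D' par' M' (A' 4) (A' 5)"
        "s' 7 = u" "s' 8 = p" "s' 9 = s 7" "s' 10 = s 8" "s' 2 = s 2" "s' 3 = p" for s' A' M'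
      using that ne' c' rc' sc' cD' unfolding peel_inv.simps by (intro exI[of _ D'] exI[of _ par'] exI[of _ M']) simp
    have kD: "s 1 \<le> Suc (card D)" "Suc (s 1) \<le> Suc (card D)" using k by auto
    have m1: "m - 1 < m" using m by simp
    note run = peel_def ev_simps u_def[symmetric] p_def[symmetric] deg'_def sm'_def
    show ?thesis
    proof (cases "A 4 u")
      case (Suc w)
      then have w: "waiting D par M u = {w}" using wu by simp
      then have "w \<in> waiting D par M u" by simp
      then have "w < n" using D by (auto simp: waiting_def)
      then have "w \<le> W" by (simp add: W_ge)
      note gu = greedy_up[OF G cp(1,2) w, folded D'_def par'_def]
      have mk': "marks n D' par' (insert {w, u, p} M) (A 4) ((A 5)(p := Suc 0))"
        using mk gu(4) w unfolding marks_def by (auto simp: D'_def waiting_def)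
      show ?thesis
        using True Suc bounds sW pn \<open>w \<le> W\<close> new[OF gu(1) _ _ _ _ _ _] records_insert[OF rec gu(2,3)] mk' kD n m1
        by (auto simp: run intro!: exI[of _ "m - 1"])
    next
      case 0
      then have w: "waiting D par M u = {}" using wu by simp
      note gs = greedy_skip[OF G cp(1,2) w, folded D'_def par'_def]
      show ?thesis
      proof (cases "u \<in> \<Union>M")
        case cu: True
        have mk': "marks n D' par' M (A 4) (A 5)"
          using mk gs(2) cu unfolding marks_def by (auto simp: D'_def)
        show ?thesis
          using True 0 cov cu bounds sW pn new[OF gs(1)] rec mk' kD n m1
          by (auto simp: run intro!: exI[of _ "m - 1"])
      next
        case cu: False
        show ?thesis
        proof (cases "A 4 p")
          case p0: 0
          have mk': "marks n D' par' M ((A 4)(p := Suc u)) (A 5)"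
            using mk gs(2) cu wp p0 unfolding marks_def by (auto simp: D'_def)
          show ?thesis
            using True 0 p0 cov cu bounds sW pn new[OF gs(1)] rec mk' kD n m1
            by (auto simp: run intro!: exI[of _ "m - 1"])
        next
          case pz: (Suc z)
          then have z: "waiting D par M p = {z}" using wp by simp
          then have "z \<in> waiting D par M p" by simp
          then have "z < n" using D by (auto simp: waiting_def)
          then have "z \<le> W" by (simp add: W_ge)
          note gp = greedy_pair[OF G cp(1,2) w cu z, folded D'_def par'_def]
          have mk': "marks n D' par' (insert {u, p, z} M) ((A 4)(p := 0)) ((A 5)(p := Suc 0))"
            using mk gp(4) z unfolding marks_def by (auto simp: D'_def waiting_def)
          show ?thesis
            using True 0 pz cov cu bounds sW pn \<open>z \<le> W\<close> new[OF gp(1)]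
              records_insert[OF rec gp(2,3)] mk' kD n m1
            by (auto simp: run intro!: exI[of _ "m - 1"])
        qed
      qed
    qed
  qed
qed

end

section \<open>Reading the edge list\<close>

lemma nbrs_insert_edge:
  "a \<noteq> b \<Longrightarrow> nbrs (insert {a, b} S) x =
     (if x = a then insert b (nbrs S a) else if x = b then insert a (nbrs S b) else nbrs S x)"
  by (auto simp: nbrs_def doubleton_eq_iff)

text \<open>\<open>f\<close> and \<open>g\<close> freeze the input arrays, and \<open>k\<close>
  counts the unread edges. Registers from 7 on stay 0 so that \<open>recent\<close> holds at the
  start of the removal loop.\<close>

fun read_inv :: "nat \<Rightarrow> nat \<Rightarrow> (nat \<Rightarrow> nat) \<Rightarrow> (nat \<Rightarrow> nat) \<Rightarrow> nat \<Rightarrow> state \<Rightarrow> bool" where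
  "read_inv n m f g k (s, A) \<longleftrightarrow> k + s 2 = m \<and> s 0 = n \<and> s 1 = m \<and> (\<forall>x\<ge>7. s x = 0) \<and>
     A 0 = f \<and> A 1 = g \<and> A 4 = (\<lambda>_. 0) \<and> A 5 = (\<lambda>_. 0) \<and>
     A 2 = (\<lambda>x. card (nbrs ((\<lambda>j. {f j, g j}) ` {..<s 2}) x)) \<and>
     A 3 = (\<lambda>x. \<Sum>(nbrs ((\<lambda>j. {f j, g j}) ` {..<s 2}) x))"

declare read_inv.simps [simp del]

context ram_tree
begin

lemma read_step:
  assumes bij: "bij_betw (\<lambda>j. {f j, g j}) {..<m} E"
    and I: "read_inv n m f g k (s, A)" and lt: "s 2 < s 1"
  shows "ev W read_edge (s, A) (\<lambda>t \<sigma>. t \<le> 15 \<and> (\<exists>k'<k. read_inv n m f g k' \<sigma>))"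
proof -
  define i where "i = s 2"
  define a b where "a = f i" and "b = g i"
  define S where "S = (\<lambda>j. {f j, g j}) ` {..<i}"
  have i: "i < m" and inv: "k + i = m" "s 0 = n" "s 1 = m" "\<And>x. x \<ge> 7 \<Longrightarrow> s x = 0"
    "A 0 = f" "A 1 = g" "A 4 = (\<lambda>_. 0)" "A 5 = (\<lambda>_. 0)"
    and A23: "A 2 = (\<lambda>x. card (nbrs S x))" "A 3 = (\<lambda>x. \<Sum>(nbrs S x))"
    using I lt by (auto simp: read_inv.simps i_def S_def)
  have "{a, b} \<in> E" using bij i by (auto simp: bij_betw_def a_def b_def)
  then have ab: "a < n" "b < n" "a \<noteq> b" using edgeD[of a b] by auto
  have "inj_on (\<lambda>j. {f j, g j}) {..<m}" using bij by (simp add: bij_betw_def)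
  \<comment> \<open>Each edge is stored only once, so both ends gain a new neighbour and increments
    count correctly.\<close>
  then have "{a, b} \<notin> S"
    using i inj_on_image_mem_iff[of "\<lambda>j. {f j, g j}" "{..<m}" i "{..<i}"]
    by (auto simp: S_def a_def b_def)
  then have fresh: "b \<notin> nbrs S a" "a \<notin> nbrs S b" by (auto simp: nbrs_def insert_commute)
  have S': "(\<lambda>j. {f j, g j}) ` {..<Suc i} = insert {a, b} S"
    by (auto simp: S_def a_def b_def lessThan_Suc)
  have "insert {a, b} S \<subseteq> E"
    using bij i unfolding bij_betw_def S'[symmetric] by fastforce
  then have sub': "nbrs (insert {a, b} S) x \<subseteq> {..<n}" for x
    using nbrs_sub[of x] unfolding nbrs_def by blast
  then have bnd: "card (nbrs (insert {a, b} S) x) \<le> W" "\<Sum>(nbrs (insert {a, b} S) x) \<le> W" for x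
    by (simp_all add: card_le_W sum_le_W)
  have fin': "finite (nbrs S x)" for x
    using finite_subset[OF _ finite_lessThan[of n]] sub'[of x] ab
    by (auto simp: nbrs_insert_edge split: if_splits)
  have upd: "A 2 a + 1 = card (nbrs (insert {a, b} S) a)" "A 2 b + 1 = card (nbrs (insert {a, b} S) b)"
    "A 3 a + b = \<Sum>(nbrs (insert {a, b} S) a)" "A 3 b + a = \<Sum>(nbrs (insert {a, b} S) b)"
    using ab fresh fin' by (auto simp: nbrs_insert_edge A23)
  have le: "A 2 a + 1 \<le> W" "A 2 b + 1 \<le> W" "A 3 a + b \<le> W" "A 3 b + a \<le> W"
    using bnd unfolding upd by blast+
  have "(A 2)(a := A 2 a + 1, b := A 2 b + 1) = (\<lambda>x. card (nbrs (insert {a, b} S) x))"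
    "(A 3)(a := A 3 a + b, b := A 3 b + a) = (\<lambda>x. \<Sum>(nbrs (insert {a, b} S) x))"
    unfolding upd using ab by (auto simp: A23 nbrs_insert_edge)
  then have new: "read_inv n m f g (k - 1) (s', A')"
    if "s' 0 = n" "s' 1 = m" "s' 2 = Suc i" "\<forall>x\<ge>7. s' x = 0" "A' 0 = f" "A' 1 = g"
      "A' 4 = (\<lambda>_. 0)" "A' 5 = (\<lambda>_. 0)" "A' 2 = (A 2)(a := Suc (A 2 a), b := Suc (A 2 b))"
      "A' 3 = (A 3)(a := A 3 a + b, b := A 3 b + a)" for s' A'
    using that i inv(1) S' by (simp add: read_inv.simps)
  have "card E \<le> card {..<n}" using acyclic_card_edges fin edges acyc by blast
  moreover have "card E = m" using bij_betw_same_card[OF bij] by simp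
  ultimately have "m \<le> n" by simp
  then have "i \<le> W" "Suc i \<le> W" "a \<le> W" "b \<le> W" using i ab by (auto intro: W_ge)
  moreover have "k - 1 < k" using i inv(1) by simp
  moreover have "A 2 a \<le> W" "A 2 b \<le> W" "A 3 a \<le> W" "A 3 b \<le> W" using le by linarith+
  ultimately show ?thesis
    using le inv(2-) new ab
    by (auto simp: read_edge_def add_neighbour_def ev_simps i_def[symmetric] a_def[symmetric]
        b_def[symmetric] intro!: exI[of _ "k - 1"])
qed

section \<open>The last path and the output\<close>

lemma stores_min_completion:
  assumes "extendable {..<n} E M" "{..<n} \<subseteq> \<Union>M" "records E (A 0) (A 1) (s 1) M"
  shows "\<exists>F. stores_edges (s, A) F \<and> min_triangle_completion {..<n} E F"
  using completion_of_records[OF assms] by (auto simp: stores_edges_def)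

lemma finish_step:
  assumes I: "peel_inv n E m (s, A)" and v: "\<not> s 2 < s 0"
  shows "ev W finish (s, A)
    (\<lambda>t \<sigma>. t \<le> 12 \<and> (\<exists>F. stores_edges \<sigma> F \<and> min_triangle_completion {..<n} E F))"
proof -
  obtain D par M where G: "greedy {..<n} E D par M" and ne: "{..<n} - D \<noteq> {}" and n: "s 0 = n"
    and rec: "records E (A 0) (A 1) (s 1) M" and k: "s 1 \<le> card D"
    and c: "counts n E D (A 2) (A 3)" and mk: "marks n D par M (A 4) (A 5)"
    and rc: "recent n D par (s 7) (s 8) (s 9) (s 10)" and sc: "scan n D m (s 2) (s 3) (A 2)"
    using I by (auto simp: peel_inv.simps)
  define x r y q where "x = s 7" and "r = s 8" and "y = s 9" and "q = s 10"
  have P: "peeled {..<n} E D par" and M: "extendable {..<n} E M" using G by (auto simp: greedy_def)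
  have D: "D \<subseteq> {..<n}" and par: "\<And>v. v \<in> D \<Longrightarrow> {v, par v} \<in> E" using P by (auto simp: peeled_def)
  have deg: "card (nbrs E z \<inter> ({..<n} - D)) \<noteq> 1" if "z \<in> {..<n} - D" for z
  proof -
    have "nbrs E z \<inter> ({..<n} - D) = nbrs E z - D" using nbrs_sub[of z] by blast
    moreover have "A 2 z \<noteq> 1" using sc v n that by (auto simp: scan_def)
    ultimately show ?thesis using c that by (auto simp: counts_def)
  qed
  obtain r' where "r' \<in> {..<n} - D" using ne by blast
  then have R': "{..<n} - D = {r'}" using peeled_last[OF P _ deg] by blast
  then have "card D = n - 1" using card_Diff_subset[of D "{..<n}"] D finite_subset[of D "{..<n}"]
    by (metis One_nat_def card_lessThan card.empty card_insert_disjoint card_mono diff_diff_cancel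
        empty_iff finite.emptyI finite_lessThan)
  then have D2: "card D \<ge> 2" and kn: "Suc (s 1) \<le> n" using n3 k by auto
  have x: "x \<in> D" "par x = r" "r \<notin> D" "r < n"
    and y: "y \<in> D" "y \<noteq> x" "par y = q" "q = x \<or> q \<notin> D" "q < n"
    using rc D2 by (auto simp: recent_def x_def r_def y_def q_def)
  have "r \<in> {..<n} - D" using x by simp
  then have R: "{..<n} - D = {r}" using R' by simp
  have xn: "x < n" "y < n" using x y D by auto
  have q: "q = r" if "q \<noteq> x" using that y R by blast
  have xr: "{x, r} \<in> E" "{y, q} \<in> E" using par[of x] par[of y] x y by auto
  \<comment> \<open>The two vertices removed last form a path with \<open>r\<close>, centred at
    \<open>x\<close> or at \<open>r\<close>.\<close>
  have px: "q = x \<Longrightarrow> path3 E y x r" "q \<noteq> x \<Longrightarrow> path3 E y r x"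
    using xr q x y by (auto simp: path3_def insert_commute)
  have wr: "waiting D par M r = (case A 4 r of 0 \<Rightarrow> {} | Suc w \<Rightarrow> {w})"
    and cov: "A 5 r = (if r \<in> \<Union>M then 1 else 0)"
    using mk x unfolding marks_def by blast+
  have cover: "{..<n} \<subseteq> insert r (waiting D par M r) \<union> \<Union>M" using greedy_cover[OF G R] .
  have done': "\<exists>F. stores_edges (s', A') F \<and> min_triangle_completion {..<n} E F"
    if w: "w < n" "w \<notin> \<Union>M" and abc: "path3 E a b c" and sub: "insert r (waiting D par M r) \<subseteq> {a, b, c}"
      and A': "A' 0 = (A 0)(s 1 := a)" "A' 1 = (A 1)(s 1 := c)" "s' 1 = Suc (s 1)" for w a b c s' A'
  proof -
    have "{..<n} \<subseteq> {a, b, c} \<union> \<Union>M" using cover sub by blast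
    note e = extendable_last[OF M _ w(2) abc this]
    have "w \<in> {..<n}" using w by simp
    note e = e[OF this]
    show ?thesis
    proof (rule stores_min_completion[OF e(1)])
      show "{..<n} \<subseteq> \<Union>(insert {a, b, c} M)" using \<open>{..<n} \<subseteq> {a, b, c} \<union> \<Union>M\<close> by simp
      show "records E (A' 0) (A' 1) (s' 1) (insert {a, b, c} M)"
        using records_insert[OF rec abc e(2)] A' by simp
    qed
  qed
  have bounds: "x \<le> W" "r \<le> W" "y \<le> W" "s 1 \<le> W" "Suc (s 1) \<le> W" "A 5 r \<le> W"
    using xn x kn cov n3 by (auto intro: W_ge)
  note run = finish_def ev_simps x_def[symmetric] r_def[symmetric] y_def[symmetric] q_def[symmetric]
  show ?thesis
  proof (cases "A 4 r")
    case 0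
    then have w0: "waiting D par M r = {}" using wr by simp
    show ?thesis
    proof (cases "r \<in> \<Union>M")
      case True
      then have "{..<n} \<subseteq> \<Union>M" using cover w0 by blast
      note fin_done = stores_min_completion[OF M this]
      show ?thesis using 0 True cov bounds fin_done[of A] rec by (auto simp: run)
    next
      case False
      show ?thesis
        using 0 False cov bounds px w0 x done'[OF _ False px(1)] done'[OF _ False px(2)]
        by (auto simp: run)
    qed
  next
    case (Suc w)
    then have ww: "waiting D par M r = {w}" using wr by simp
    then have "w \<in> waiting D par M r" by simp
    then have w: "w \<in> D" "par w = r" "w \<notin> \<Union>M" "w < n" using D by (auto simp: waiting_def)
    then have "w \<le> W" "Suc w \<le> W" by (auto intro: W_ge)
    moreover have "path3 E w r x" if "w \<noteq> x"
      using that par[OF w(1)] w xr by (auto simp: path3_def insert_commute)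
    ultimately show ?thesis
      using Suc bounds ww w px done'[OF w(4) w(3) px(1)] done'[OF w(4) w(3) px(2)]
        done'[OF w(4) w(3), of w r x]
      by (auto simp: run)
  qed
qed

text \<open>Reading takes at most \<open>16 * m + 1\<close> steps and the rest at most
  \<open>62 * n + 16\<close>; since \<open>m \<le> n\<close> and \<open>n \<ge> 3\<close>, the sum
  is at most \<open>100 * n\<close>.\<close>

lemma complete_tree_correct:
  assumes "input_state n E \<sigma>"
  shows "ev W complete_tree \<sigma>
    (\<lambda>t \<sigma>'. t \<le> 100 * n \<and> (\<exists>F. stores_edges \<sigma>' F \<and> min_triangle_completion {..<n} E F))"
proof -
  obtain s A where \<sigma>: "\<sigma> = (s, A)" by force
  define m f g where "m = s 1" and "f = A 0" and "g = A 1"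
  have bij: "bij_betw (\<lambda>j. {f j, g j}) {..<m} E" and s: "s 0 = n" "\<And>x. x \<ge> 2 \<Longrightarrow> s x = 0"
    and A: "\<And>a. a \<ge> 2 \<Longrightarrow> A a = (\<lambda>_. 0)"
    using assms by (auto simp: \<sigma> input_state_def stores_edges_def m_def f_def g_def)
  have "card E \<le> card {..<n}" using acyclic_card_edges fin edges acyc by blast
  then have mn: "m \<le> n" using bij_betw_same_card[OF bij] by simp
  have start: "read_inv n m f g m \<sigma>"
    using s A by (simp add: \<sigma> read_inv.simps m_def f_def g_def nbrs_def)
  have reading: "ev W (While (Less (V 2) (V 1)) read_edge) \<sigma>
      (\<lambda>t \<sigma>'. t \<le> Suc 15 * m + 1 \<and> \<not> holds (Less (V 2) (V 1)) (fst \<sigma>') \<and>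
        (\<exists>k. read_inv n m f g k \<sigma>'))"
    by (rule ev_While[where I = "read_inv n m f g", OF start]) (use read_step[OF bij] in auto)
  have main: "ev W (Assign 1 (N 0) ;; Assign 2 (N 0) ;; Assign 3 (N 0) ;;
       While (Less (V 2) (V 0)) peel ;; finish) (s, A)
       (\<lambda>t \<sigma>'. t \<le> 62 * n + 16 \<and> (\<exists>F. stores_edges \<sigma>' F \<and> min_triangle_completion {..<n} E F))"
    if R: "read_inv n m f g k (s, A)" and stop: "\<not> s 2 < s 1" for k s A
  proof -
    let ?s = "s(1 := 0, 2 := 0, 3 := 0)"
    have "s 2 = m" using R stop by (auto simp: read_inv.simps)
    then have "(\<lambda>j. {f j, g j}) ` {..<s 2} = E" using bij by (simp add: bij_betw_def)
    then have "counts n E {} (A 2) (A 3)" using R by (auto simp: counts_def read_inv.simps)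
    \<comment> \<open>Nothing is removed yet, so \<open>id\<close> is a mere placeholder for the
      parent function.\<close>
    moreover have "marks n {} id {} (A 4) (A 5)"
      using R by (auto simp: marks_def waiting_def read_inv.simps)
    moreover have "greedy {..<n} E {} id {}"
      using cut_conn by (auto simp: greedy_def peeled_def extendable_def)
    moreover have "records E (A 0) (A 1) 0 {}" by (simp add: records_def)
    moreover have "recent n {} id 0 0 0 0" "scan n {} (2 * n) 0 0 (A 2)"
      using n3 by (auto simp: recent_def scan_def)
    moreover have "{..<n} - {} \<noteq> {}" using n3 by (simp add: lessThan_empty_iff)
    ultimately have J: "peel_inv n E (2 * n) (?s, A)"
      using R unfolding peel_inv.simps
      by (intro exI[of _ "{}"] exI[of _ id]) (auto simp: read_inv.simps)
    have loop: "ev W (While (Less (V 2) (V 0)) peel) (?s, A)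
        (\<lambda>t \<sigma>'. t \<le> Suc 30 * (2 * n) + 1 \<and> \<not> holds (Less (V 2) (V 0)) (fst \<sigma>') \<and>
          (\<exists>m. peel_inv n E m \<sigma>'))"
      by (rule ev_While[where I = "peel_inv n E", OF J]) (use peel_step in auto)
    have looped: "ev W (While (Less (V 2) (V 0)) peel ;; finish) (?s, A)
       (\<lambda>t \<sigma>'. t \<le> 62 * n + 13 \<and> (\<exists>F. stores_edges \<sigma>' F \<and> min_triangle_completion {..<n} E F))"
      unfolding ev_Seq
    proof (rule ev_mono[OF loop], elim conjE exE)
      fix t \<sigma>' m'
      assume t: "t \<le> Suc 30 * (2 * n) + 1" and h: "\<not> holds (Less (V 2) (V 0)) (fst \<sigma>')"
        and I: "peel_inv n E m' \<sigma>'"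
      obtain s' A' where \<sigma>': "\<sigma>' = (s', A')" by force
      show "ev W finish \<sigma>' (\<lambda>t' \<sigma>''. t + t' \<le> 62 * n + 13 \<and>
          (\<exists>F. stores_edges \<sigma>'' F \<and> min_triangle_completion {..<n} E F))"
        unfolding \<sigma>'
        by (rule ev_mono[OF finish_step]) (use t h I in \<open>auto simp: \<sigma>'\<close>)
    qed
    have assign: "ev W (Assign x (N 0) ;; c) (s, A) Q \<longleftrightarrow> ev W c (s(x := 0), A) (\<lambda>t. Q (1 + t))"
      for x c s A Q by (simp add: ev_Seq ev_Assign)
    show ?thesis unfolding assign by (rule ev_mono[OF looped]) auto
  qed
  show ?thesis
    unfolding complete_tree_def ev_Seq[of _ "While (Less (V 2) (V 1)) read_edge"]
  proof (rule ev_mono[OF reading], elim conjE exE)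
    fix t \<sigma>' k
    assume t: "t \<le> Suc 15 * m + 1" and h: "\<not> holds (Less (V 2) (V 1)) (fst \<sigma>')"
      and I: "read_inv n m f g k \<sigma>'"
    obtain s' A' where \<sigma>': "\<sigma>' = (s', A')" by force
    show "ev W (Assign 1 (N 0) ;; Assign 2 (N 0) ;; Assign 3 (N 0) ;;
        While (Less (V 2) (V 0)) peel ;; finish) \<sigma>'
        (\<lambda>t' \<sigma>''. t + t' \<le> 100 * n \<and>
          (\<exists>F. stores_edges \<sigma>'' F \<and> min_triangle_completion {..<n} E F))"
      unfolding \<sigma>'
      by (rule ev_mono[OF main]) (use t h I mn n3 in \<open>auto simp: \<sigma>'\<close>)
  qed
qed

end

theorem theorem6p5:
  shows "\<exists>(prog :: com) (c :: nat) (d :: nat).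
    \<forall>(n :: nat) (E :: nat set set) (\<sigma> :: state).
      n \<ge> 3 \<and> tree_graph {..<n} E \<and> input_state n E \<sigma> \<longrightarrow>
      (\<exists>t \<sigma>' F. exec (n ^ d) prog \<sigma> t \<sigma>' \<and> t \<le> c * n \<and>
         stores_edges \<sigma>' F \<and> min_triangle_completion {..<n} E F)"
proof (rule exI[of _ complete_tree], rule exI[of _ 100], rule exI[of _ 2], intro allI impI, elim conjE)
  fix n E \<sigma>
  assume "n \<ge> 3" "tree_graph {..<n} E" and \<sigma>: "input_state n E \<sigma>"
  then interpret ram_tree n E "n ^ 2"
    by unfold_locales (auto simp: power2_eq_square)
  show "\<exists>t \<sigma>' F. exec (n ^ 2) complete_tree \<sigma> t \<sigma>' \<and> t \<le> 100 * n \<and>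
      stores_edges \<sigma>' F \<and> min_triangle_completion {..<n} E F"
    using complete_tree_correct[OF \<sigma>] unfolding ev_def by blast
qed

end
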